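(* For every integer $\ell\ge 2$, \[\tilde{r}(P_3,P_3,P_\ell)=\begin{cases}3\ell/2-1, & \text{if } \ell \equiv 0\pmod{4}\ \text{and}\ \ell\ge 8; \\ \left\lfloor 3\ell/2 \right\rfloor, & \text{otherwise}. \end{cases}\]
   Context: $P_m$ denotes the path on $m$ vertices. The three-color online Ramsey game for graphs $G_1,G_2,G_3$ is played by Builder and Painter on an infinite vertex set with initially no edges. In each round Builder draws an edge between two currently nonadjacent vertices, and Painter immediately colors it with one of the colors red, blue, green. Builder wins once the colored graph contains a red copy of $G_1$, a blue copy of $G_2$, or a green copy of $G_3$ (as a subgraph). The online Ramsey number $\tilde{r}(G_1,G_2,G_3)$ is the minimum number of rounds within which Builder can guarantee a win against every strategy of Painter. *)

theory Defs
  imports Main "HOL-Library.Extended_Nat"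
begin

text \<open>A graph is a pair of a vertex set and a set of edges, each edge being a two-element set.\<close>

type_synonym 'a ugraph = "'a set \<times> 'a set set"

definition path_graph :: "nat \<Rightarrow> nat ugraph" where
  "path_graph m = ({..<m}, {{i, Suc i} |i. Suc i < m})"

text \<open>The board has vertex set \<open>UNIV :: nat set\<close>, so only its edge set is passed here. The copy
  need not be induced.\<close>

definition contains_copy :: "nat set set \<Rightarrow> 'a ugraph \<Rightarrow> bool" where
  "contains_copy E G \<longleftrightarrow> (\<exists>f. inj_on f (fst G) \<and> (\<forall>e \<in> snd G. f ` e \<in> E))"

datatype color = Red | Blue | Green

text \<open>The rounds played so far, most recent first; each is the edge drawn and the color it got.\<close>

type_synonym history = "(nat set \<times> color) list"

type_synonym builder_strategy = "history \<Rightarrow> nat set"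

type_synonym painter_strategy = "history \<Rightarrow> nat set \<Rightarrow> color"

text \<open>Asking for a legal move after every history, reachable or not, is no restriction, since the
  board is infinite and a history is finite.\<close>

definition legal_builder :: "builder_strategy \<Rightarrow> bool" where
  "legal_builder \<sigma> \<longleftrightarrow>
     (\<forall>h. \<exists>u v. u \<noteq> v \<and> \<sigma> h = {u, v} \<and> {u, v} \<notin> fst ` set h)"

primrec play :: "builder_strategy \<Rightarrow> painter_strategy \<Rightarrow> nat \<Rightarrow> history" where
  "play \<sigma> \<tau> 0 = []"
| "play \<sigma> \<tau> (Suc n) = (let h = play \<sigma> \<tau> n; e = \<sigma> h in (e, \<tau> h e) # h)"

definition color_class :: "history \<Rightarrow> color \<Rightarrow> nat set set" where
  "color_class h c = {e. (e, c) \<in> set h}"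

definition builder_won :: "'a ugraph \<Rightarrow> 'b ugraph \<Rightarrow> 'c ugraph \<Rightarrow> history \<Rightarrow> bool" where
  "builder_won G1 G2 G3 h \<longleftrightarrow>
     contains_copy (color_class h Red) G1 \<or>
     contains_copy (color_class h Blue) G2 \<or>
     contains_copy (color_class h Green) G3"

definition builder_wins_within :: "'a ugraph \<Rightarrow> 'b ugraph \<Rightarrow> 'c ugraph \<Rightarrow> nat \<Rightarrow> bool" where
  "builder_wins_within G1 G2 G3 n \<longleftrightarrow>
     (\<exists>\<sigma>. legal_builder \<sigma> \<and> (\<forall>\<tau>. \<exists>k\<le>n. builder_won G1 G2 G3 (play \<sigma> \<tau> k)))"

text \<open>The value is \<open>\<infinity>\<close> if Builder cannot guarantee a win within any fixed number of rounds.\<close>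

definition online_ramsey :: "'a ugraph \<Rightarrow> 'b ugraph \<Rightarrow> 'c ugraph \<Rightarrow> enat" where
  "online_ramsey G1 G2 G3 = Inf (enat ` {n. builder_wins_within G1 G2 G3 n})"

end

theory Submission
  imports Defs "HOL-Library.Disjoint_Sets"
begin

text \<open>
  Call a vertex half if it meets a red or a blue edge, and full if it meets both. Every further edge at a
  full vertex is forced to be green.

  Lower bound: Painter avoids green whenever possible. The vertices on red edges then cover every green
  edge, and so do those on blue edges; hence a green path on \<open>l\<close> vertices needs at least \<open>l div 2\<close>
  vertices on red edges and as many on blue ones. For \<open>l = 4 q + 1\<close> this is one edge short, because
  the red and blue edges could form alternating cycles on the same \<open>2 q\<close> vertices; there Painter also
  colors green every edge that would close a red-blue cycle.

  Upper bound: Builder keeps a green path and judges a position by the slack \<open>2 n + 3 m - 3 l\<close>, where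
  \<open>n\<close> is the number of remaining rounds and \<open>m\<close> the number of vertices of the path. Drawing an edge
  lowers the slack by 2 and a new path vertex raises it by 3. When the path ends in a full vertex and
  there is a half vertex off it, three rounds around that half vertex either lengthen the path by two
  and reproduce the situation, or lengthen the path by three. This makes slack 3 winning for every green
  path; if the ends of the path are half or full, smaller slack suffices.
\<close>

section \<open>Positions of the game and a recursion for forced wins\<close>

abbreviation won :: "nat \<Rightarrow> history \<Rightarrow> bool" where
  "won l h \<equiv> builder_won (path_graph 3) (path_graph 3) (path_graph l) h"

definition drawn :: "history \<Rightarrow> nat \<Rightarrow> nat \<Rightarrow> bool" where
  "drawn h u v \<longleftrightarrow> {u, v} \<in> fst ` set h"

definition green :: "history \<Rightarrow> nat \<Rightarrow> nat \<Rightarrow> bool" where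
  "green h u v \<longleftrightarrow> ({u, v}, Green) \<in> set h"

definition touched :: "history \<Rightarrow> color \<Rightarrow> nat \<Rightarrow> bool" where
  "touched h c x \<longleftrightarrow> (\<exists>y. y \<noteq> x \<and> ({x, y}, c) \<in> set h)"

definition half :: "history \<Rightarrow> nat \<Rightarrow> bool" where
  "half h x \<longleftrightarrow> touched h Red x \<or> touched h Blue x"

definition full :: "history \<Rightarrow> nat \<Rightarrow> bool" where
  "full h x \<longleftrightarrow> touched h Red x \<and> touched h Blue x"

definition verts :: "history \<Rightarrow> nat set" where
  "verts h = {x. \<exists>v. drawn h x v}"

definition green_path :: "history \<Rightarrow> nat list \<Rightarrow> bool" where
  "green_path h xs \<longleftrightarrow> distinct xs \<and> successively (green h) xs"

text \<open>Backward induction over the game tree, with \<open>n\<close> the number of remaining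
  rounds. Strategies as functions of the history enter only in
  \<open>builder_wins_within_if_forced_win\<close>.\<close>

primrec forced_win :: "nat \<Rightarrow> nat \<Rightarrow> history \<Rightarrow> bool" where
  "forced_win l 0 h \<longleftrightarrow> won l h"
| "forced_win l (Suc n) h \<longleftrightarrow> won l h \<or>
     (\<exists>u v. u \<noteq> v \<and> \<not> drawn h u v \<and> (\<forall>c. forced_win l n (({u, v}, c) # h)))"

lemma drawn_Cons [simp]:
  "drawn (({u, v}, c) # h) x y \<longleftrightarrow> (u = x \<and> v = y \<or> u = y \<and> v = x) \<or> drawn h x y"
  by (auto simp: drawn_def doubleton_eq_iff)

lemma drawn_sym: "drawn h x y \<longleftrightarrow> drawn h y x"
  by (simp add: drawn_def insert_commute)

lemma green_Cons [simp]:
  "green (({u, v}, c) # h) x y \<longleftrightarrow>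
     (c = Green \<and> (u = x \<and> v = y \<or> u = y \<and> v = x)) \<or> green h x y"
  by (auto simp: green_def doubleton_eq_iff)

lemma green_sym: "green h x y \<longleftrightarrow> green h y x"
  by (simp add: green_def insert_commute)

lemma touched_Cons [simp]:
  "touched (({u, v}, c) # h) d x \<longleftrightarrow> (d = c \<and> u \<noteq> v \<and> (x = u \<or> x = v)) \<or> touched h d x"
  by (auto simp: touched_def doubleton_eq_iff)

lemma half_mono [simp]: "half h x \<Longrightarrow> half (({u, v}, c) # h) x"
  by (auto simp: half_def)

lemma full_mono [simp]: "full h x \<Longrightarrow> full (({u, v}, c) # h) x"
  by (auto simp: full_def)

lemma verts_Cons [simp]: "verts (({u, v}, c) # h) = {u, v} \<union> verts h"
  by (auto simp: verts_def)

lemma half_in_verts: "half h x \<Longrightarrow> x \<in> verts h"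
  by (force simp: half_def touched_def verts_def drawn_def)

lemma not_drawn: "x \<notin> verts h \<Longrightarrow> \<not> drawn h x y" "x \<notin> verts h \<Longrightarrow> \<not> drawn h y x"
  using drawn_sym by (auto simp: verts_def)

lemma finite_verts [simp]: "finite (verts h)"
proof (rule finite_subset)
  show "verts h \<subseteq> \<Union> {e \<in> fst ` set h. finite e}"
    by (auto simp: verts_def drawn_def)
qed auto

lemma obtain_fresh:
  assumes "finite (V :: nat set)"
  obtains x where "x \<notin> V" "x \<notin> verts h"
  using ex_new_if_finite[OF infinite_UNIV_nat, of "V \<union> verts h"] assms by auto

lemma green_path_Cons2 [simp]:
  "green_path h (y # x # xs) \<longleftrightarrow> y \<notin> set (x # xs) \<and> green h y x \<and> green_path h (x # xs)"
  by (auto simp: green_path_def)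

lemma green_path_single [simp]: "green_path h [x]"
  by (simp add: green_path_def)

lemma green_path_mono [simp]:
  assumes "green_path h xs"
  shows "green_path (({u, v}, c) # h) xs"
proof -
  have "successively (green (({u, v}, c) # h)) xs"
    by (rule successively_mono[of "green h"]) (use assms in \<open>auto simp: green_path_def\<close>)
  thus ?thesis using assms by (simp add: green_path_def)
qed

lemma green_path_rev [simp]: "green_path h (rev xs) \<longleftrightarrow> green_path h xs"
proof -
  have "(\<lambda>x y. green h y x) = green h"
    by (intro ext) (rule green_sym)
  hence "successively (\<lambda>x y. green h y x) xs = successively (green h) xs"
    by (rule arg_cong)
  thus ?thesis unfolding green_path_def by simp
qed

lemma contains_copy_path_graph:
  assumes "distinct xs" "successively (\<lambda>x y. {x, y} \<in> E) xs" "m \<le> length xs"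
  shows "contains_copy E (path_graph m)"
  unfolding contains_copy_def
proof (intro exI conjI)
  show "inj_on (nth xs) (fst (path_graph m))"
    using assms by (auto simp: path_graph_def inj_on_def nth_eq_iff_index_eq)
  show "\<forall>e\<in>snd (path_graph m). nth xs ` e \<in> E"
    using assms by (auto simp: path_graph_def successively_conv_nth)
qed

lemma won_green_path:
  assumes "green_path h xs" "l \<le> length xs"
  shows "won l h"
  using assms contains_copy_path_graph[of xs "color_class h Green" l]
  by (auto simp: builder_won_def green_path_def green_def[abs_def] color_class_def)

lemma won_touched:
  assumes "touched h c u" "c \<noteq> Green" "u \<noteq> v" "\<not> drawn h u v"
  shows "won l (({u, v}, c) # h)"
proof -
  obtain y where y: "y \<noteq> u" "({u, y}, c) \<in> set h"
    using assms by (auto simp: touched_def)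
  have "y \<noteq> v"
    using y assms by (force simp: drawn_def)
  with y assms have "contains_copy (color_class (({u, v}, c) # h) c) (path_graph 3)"
    by (intro contains_copy_path_graph[of "[y, u, v]"])
       (auto simp: color_class_def insert_commute)
  thus ?thesis
    using assms(2) by (cases c) (auto simp: builder_won_def)
qed

section \<open>Moves of Builder and the answers left to Painter\<close>

lemma forced_win_if_won: "won l h \<Longrightarrow> forced_win l n h"
  by (cases n) auto

lemma forced_win_green_path: "green_path h xs \<Longrightarrow> l \<le> length xs \<Longrightarrow> forced_win l n h"
  by (intro forced_win_if_won won_green_path)

text \<open>A red or blue answer at a vertex already touched by that color completes a monochromatic
  \<open>P_3\<close>, so only the other answers need a continuation. The rules for drawing edges
  below all rest on this one.\<close>

lemma forced_win_step:
  assumes "u \<noteq> v" "\<not> drawn h u v"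
    and "\<And>c. c \<noteq> Green \<Longrightarrow> \<not> touched h c u \<Longrightarrow> \<not> touched h c v \<Longrightarrow> forced_win l n (({u, v}, c) # h)"
    and "forced_win l n (({u, v}, Green) # h)"
  shows "forced_win l (Suc n) h"
proof -
  have "forced_win l n (({u, v}, c) # h)" for c
  proof (cases "c = Green \<or> \<not> touched h c u \<and> \<not> touched h c v")
    case False
    hence "won l (({u, v}, c) # h)"
      using won_touched[of h c u v l] won_touched[of h c v u l] assms(1,2)
      by (auto simp: insert_commute drawn_sym[of h v u])
    thus ?thesis by (rule forced_win_if_won)
  next
    case True
    thus ?thesis using assms(3,4) by (cases "c = Green") auto
  qed
  with assms(1,2) show ?thesis by auto
qed

lemma color_cases: "c \<noteq> Green \<Longrightarrow> c = Red \<or> c = Blue"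
  by (cases c) auto

lemma draw_any:
  assumes "u \<noteq> v" "\<not> drawn h u v"
    and "\<And>c. half (({u, v}, c) # h) u \<Longrightarrow> half (({u, v}, c) # h) v \<Longrightarrow> forced_win l n (({u, v}, c) # h)"
    and "forced_win l n (({u, v}, Green) # h)"
  shows "forced_win l (Suc n) h"
  using assms by (intro forced_win_step[of u v]) (auto simp: half_def dest!: color_cases)

text \<open>One of red and blue is already blocked at \<open>u\<close>, so an answer other than
  green supplies exactly the color that \<open>u\<close> lacks.\<close>

lemma draw_at_half:
  assumes "half h u" "u \<noteq> v" "\<not> drawn h u v"
    and "\<And>c. full (({u, v}, c) # h) u \<Longrightarrow> half (({u, v}, c) # h) v \<Longrightarrow> forced_win l n (({u, v}, c) # h)"
    and "forced_win l n (({u, v}, Green) # h)"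
  shows "forced_win l (Suc n) h"
  using assms by (intro forced_win_step[of u v]) (auto simp: half_def full_def dest!: color_cases)

lemma draw_forced:
  assumes "u \<noteq> v" "\<not> drawn h u v"
    and "touched h Red u \<or> touched h Red v" "touched h Blue u \<or> touched h Blue v"
    and "forced_win l n (({u, v}, Green) # h)"
  shows "forced_win l (Suc n) h"
  using assms by (intro forced_win_step[of u v]) (auto dest!: color_cases)

lemma draw_at_full:
  assumes "full h u" "u \<noteq> v" "\<not> drawn h u v" "forced_win l n (({u, v}, Green) # h)"
  shows "forced_win l (Suc n) h"
  using assms by (intro draw_forced[of u v]) (auto simp: full_def)

subsection \<open>Builder\<close>

text \<open>In the first outcome \<open>x\<close> is a new half vertex that takes over the role of \<open>p\<close>.\<close>

lemma full_end_cycle: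
  assumes path: "green_path h (f # xs)" and f: "full h f" and p: "half h p" "p \<notin> set (f # xs)"
    and alive: "\<And>h' z x d. \<lbrakk>set h \<subseteq> set h'; green_path h' (p # z # f # xs); full h' p;
        d \<noteq> Green; touched h' d x; \<not> touched h d p; x \<notin> verts h; z \<notin> verts h;
        x \<notin> set (p # z # f # xs); \<And>v. drawn h' x v \<Longrightarrow> v = p\<rbrakk> \<Longrightarrow> forced_win l n h'"
    and dead: "\<And>h' x y. \<lbrakk>set h \<subseteq> set h'; green_path h' (y # p # x # f # xs);
        x \<notin> verts h; y \<notin> verts h; \<And>v. drawn h' y v \<Longrightarrow> v = p\<rbrakk> \<Longrightarrow> forced_win l n h'"
  shows "forced_win l (n + 3) h"
proof -
  define V where "V = insert p (set (f # xs))"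
  obtain x where x: "x \<notin> V" "x \<notin> verts h"
    by (rule obtain_fresh[of V h]) (simp add: V_def)
  obtain y where y: "y \<notin> insert x V" "y \<notin> verts h"
    by (rule obtain_fresh[of "insert x V" h]) (simp add: V_def)
  note fresh = x y not_drawn[OF x(2)] not_drawn[OF y(2)]
  note simps = fresh V_def path f p
  have "forced_win l (Suc (Suc (Suc n))) h"
  \<comment> \<open>Once a red or blue answer makes \<open>p\<close> full, a fresh vertex gets green
    edges to both \<open>f\<close> and \<open>p\<close>: \<open>y\<close> if the first answer is red
    or blue, \<open>x\<close> if only the second one is. After two green answers the forced edge
    \<open>f x\<close> attaches the path \<open>y p x\<close>.\<close>
  proof (rule forced_win_step[of p x])
    show "p \<noteq> x" "\<not> drawn h p x" using fresh by (auto simp: V_def)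
  next
    fix c assume c: "c \<noteq> Green" "\<not> touched h c p" "\<not> touched h c x"
    let ?h = "({p, x}, c) # h"
    have full: "full ?h p"
      using c p(1) x by (auto simp: full_def half_def V_def dest!: color_cases)
    show "forced_win l (Suc (Suc n)) ?h"
    proof (rule draw_at_full[of _ f y])
      let ?h' = "({f, y}, Green) # ?h"
      show "forced_win l (Suc n) ?h'"
      proof (rule draw_at_full[of _ p y])
        let ?h'' = "({p, y}, Green) # ?h'"
        show "forced_win l n ?h''"
          by (rule alive[of _ y c x]) (use simps full c in auto)
      qed (use simps full in auto)
    qed (use simps in auto)
  next
    let ?h = "({p, x}, Green) # h"
    show "forced_win l (Suc (Suc n)) ?h"
    proof (rule forced_win_step[of p y])
      show "p \<noteq> y" "\<not> drawn ?h p y" using fresh by (auto simp: V_def)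
    next
      fix c assume c: "c \<noteq> Green" "\<not> touched ?h c p" "\<not> touched ?h c y"
      let ?h' = "({p, y}, c) # ?h"
      have full: "full ?h' p"
        using c p(1) y by (auto simp: full_def half_def V_def dest!: color_cases)
      show "forced_win l (Suc n) ?h'"
      proof (rule draw_at_full[of _ f x])
        let ?h'' = "({f, x}, Green) # ?h'"
        show "forced_win l n ?h''"
          by (rule alive[of _ x c y]) (use simps full c in auto)
      qed (use simps in auto)
    next
      let ?h' = "({p, y}, Green) # ?h"
      show "forced_win l (Suc n) ?h'"
      proof (rule draw_at_full[of _ f x])
        let ?h'' = "({f, x}, Green) # ?h'"
        show "forced_win l n ?h''"
          by (rule dead[of _ y x]) (use simps in auto)
      qed (use simps in auto)
    qed
  qed
  thus ?thesis by (simp add: numeral_3_eq_3)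
qed

section \<open>Winning positions measured by their slack\<close>

lemma touched_subset: "touched h c x \<Longrightarrow> set h \<subseteq> set h' \<Longrightarrow> touched h' c x"
  by (auto simp: touched_def)

lemma half_subset: "half h x \<Longrightarrow> set h \<subseteq> set h' \<Longrightarrow> half h' x"
  by (auto simp: half_def intro: touched_subset)

lemma full_subset: "full h x \<Longrightarrow> set h \<subseteq> set h' \<Longrightarrow> full h' x"
  by (auto simp: full_def intro: touched_subset)

lemma touched_imp_half: "touched h c x \<Longrightarrow> c \<noteq> Green \<Longrightarrow> half h x"
  by (auto simp: half_def dest!: color_cases)

lemma extend_at_full:
  assumes "green_path h (f # xs)" "full h f" "l \<le> Suc (length (f # xs))"
  shows "forced_win l (Suc n) h"
proof -
  obtain z where z: "z \<notin> set (f # xs)" "z \<notin> verts h"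
    by (rule obtain_fresh[of "set (f # xs)" h]) simp
  show ?thesis
  proof (rule draw_at_full[of _ f z])
    show "forced_win l n (({f, z}, Green) # h)"
      by (rule forced_win_green_path[of _ "z # f # xs"]) (use assms z in auto)
  qed (use assms z not_drawn[OF z(2)] in auto)
qed

text \<open>The slack required is 3 in \<open>?W\<close>, 0 in \<open>?A\<close>, -1 in
  \<open>?D\<close> and 2 in \<open>?C\<close>. The four are proved together because Painter's
  answers lead from \<open>?W\<close> to \<open>?W\<close>, \<open>?C\<close> or \<open>?D\<close>,
  from \<open>?A\<close> to \<open>?A\<close> or \<open>?W\<close>, from \<open>?D\<close> to
  \<open>?D\<close> or \<open>?C\<close>, and from \<open>?C\<close> to \<open>?W\<close> or
  \<open>?A\<close>. At 2 lost per round and 3 gained per path vertex, each transition arrives with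
  at least the slack that its target requires.\<close>

lemma states_win:
  "(\<forall>h xs. green_path h xs \<longrightarrow> xs \<noteq> [] \<longrightarrow> 3 * l + 3 \<le> 2 * n + 3 * length xs \<longrightarrow> forced_win l n h) \<and>
   (\<forall>h f xs p. green_path h (f # xs) \<longrightarrow> full h f \<longrightarrow> half h p \<longrightarrow> p \<notin> set (f # xs) \<longrightarrow>
      3 * l \<le> 2 * n + 3 * length (f # xs) \<longrightarrow> forced_win l n h) \<and>
   (\<forall>h f xs p p'. green_path h (f # xs) \<longrightarrow> full h f \<longrightarrow> half h p \<longrightarrow> p \<notin> set (f # xs) \<longrightarrow>
      half h p' \<longrightarrow> p' \<notin> set (f # xs) \<longrightarrow> p \<noteq> p' \<longrightarrow>
      3 * l \<le> 2 * n + 3 * length (f # xs) + 1 \<longrightarrow> forced_win l n h) \<and>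
   (\<forall>h q xs p. green_path h (q # xs) \<longrightarrow> half h p \<longrightarrow> p \<notin> set (q # xs) \<longrightarrow> \<not> drawn h q p \<longrightarrow>
      3 * l + 2 \<le> 2 * n + 3 * length (q # xs) \<longrightarrow> forced_win l n h)"
  (is "?W n \<and> ?A n \<and> ?D n \<and> ?C n")
proof (induction n rule: less_induct)
  case (less n)
  have W: "forced_win l m h" if "m < n" "green_path h xs" "xs \<noteq> []"
    "3 * l + 3 \<le> 2 * m + 3 * length xs" for m h xs
    using less[OF that(1)] that(2-) by blast
  have A: "forced_win l m h" if "m < n" "green_path h (f # xs)" "full h f" "half h p"
    "p \<notin> set (f # xs)" "3 * l \<le> 2 * m + 3 * length (f # xs)" for m h f xs p
    using less[OF that(1)] that(2-) by blast
  have D: "forced_win l m h" if "m < n" "green_path h (f # xs)" "full h f" "half h p"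
    "p \<notin> set (f # xs)" "half h p'" "p' \<notin> set (f # xs)" "p \<noteq> p'"
    "3 * l \<le> 2 * m + 3 * length (f # xs) + 1" for m h f xs p p'
    using less[OF that(1)] that(2-) by blast
  have C: "forced_win l m h" if "m < n" "green_path h (q # xs)" "half h p"
    "p \<notin> set (q # xs)" "\<not> drawn h q p" "3 * l + 2 \<le> 2 * m + 3 * length (q # xs)" for m h q xs p
    using less[OF that(1)] that(2-) by blast
  have "?W n"
  proof (intro allI impI)
    fix h xs assume path: "green_path h xs" and ne: "xs \<noteq> []"
      and K: "3 * l + 3 \<le> 2 * n + 3 * length xs"
    show "forced_win l n h"
    proof (cases "l \<le> length xs")
      case True thus ?thesis using path forced_win_green_path by blast
    next
      case False
      then obtain m where n: "n = Suc (Suc m)"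
        using K by (intro that[of "n - 2"]) linarith
      obtain u ys where xs: "xs = u # ys" using ne by (cases xs) auto
      obtain x where x: "x \<notin> set xs" "x \<notin> verts h"
        by (rule obtain_fresh[of "set xs" h]) simp
      obtain y where y: "y \<notin> insert x (set xs)" "y \<notin> verts h"
        by (rule obtain_fresh[of "insert x (set xs)" h]) simp
      note simps = x y not_drawn[OF x(2)] not_drawn[OF y(2)] path xs
      show ?thesis unfolding n
      proof (rule draw_any[of u x])
        show "forced_win l (Suc m) (({u, x}, Green) # h)"
          by (rule W[of _ _ "x # xs"]) (use simps n K in auto)
        fix c let ?h = "({u, x}, c) # h"
        assume half: "half ?h u" "half ?h x"
        show "forced_win l (Suc m) ?h"
        proof (rule draw_at_half[of _ u y])
          show "forced_win l m (({u, y}, Green) # ?h)"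
            by (rule C[of _ _ y xs x]) (use simps n K half in auto)
          fix d let ?h' = "({u, y}, d) # ?h"
          assume "full ?h' u" "half ?h' y"
          thus "forced_win l m ?h'"
            by (intro D[of m ?h' u ys x y]) (use simps n K half in auto)
        qed (use simps half in auto)
      qed (use simps in auto)
    qed
  qed
  moreover have "?A n"
  proof (intro allI impI)
    fix h f xs p assume path: "green_path h (f # xs)" and f: "full h f"
      and p: "half h p" "p \<notin> set (f # xs)" and K: "3 * l \<le> 2 * n + 3 * length (f # xs)"
    \<comment> \<open>With a single vertex missing, the three rounds of
      \<open>full_end_cycle\<close> need not fit into \<open>n\<close>, but one forced edge at
      \<open>f\<close> finishes.\<close>
    consider "l \<le> length (f # xs)" | "l = Suc (length (f # xs))" | "l \<ge> Suc (Suc (length (f # xs)))"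
      by linarith
    thus "forced_win l n h"
    proof cases
      case 1 thus ?thesis using path forced_win_green_path by blast
    next
      case 2
      then obtain m where "n = Suc m" using K by (cases n) auto
      thus ?thesis using extend_at_full[OF path f] 2 by simp
    next
      case 3
      then obtain m where n: "n = m + 3" using K by (intro that[of "n - 3"]) linarith
      show ?thesis unfolding n
      proof (rule full_end_cycle[OF path f p])
        fix h' z x d
        assume "green_path h' (p # z # f # xs)" "full h' p" "d \<noteq> Green" "touched h' d x"
          "x \<notin> set (p # z # f # xs)"
        thus "forced_win l m h'"
          by (intro A[of m h' p "z # f # xs" x]) (use n K in \<open>auto intro: touched_imp_half\<close>)
      next
        fix h' x y assume "green_path h' (y # p # x # f # xs)"
        thus "forced_win l m h'"
          by (intro W[of m h' "y # p # x # f # xs"]) (use n K in auto)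
      qed
    qed
  qed
  moreover have "?D n"
  proof (intro allI impI)
    fix h f xs p p' assume path: "green_path h (f # xs)" and f: "full h f"
      and p: "half h p" "p \<notin> set (f # xs)" and p': "half h p'" "p' \<notin> set (f # xs)" "p \<noteq> p'"
      and K: "3 * l \<le> 2 * n + 3 * length (f # xs) + 1"
    consider "l \<le> length (f # xs)" | "l = Suc (length (f # xs))" | "l \<ge> Suc (Suc (length (f # xs)))"
      by linarith
    thus "forced_win l n h"
    proof cases
      case 1 thus ?thesis using path forced_win_green_path by blast
    next
      case 2
      then obtain m where "n = Suc m" using K by (cases n) auto
      thus ?thesis using extend_at_full[OF path f] 2 by simp
    next
      case 3
      then obtain m where n: "n = m + 3" using K by (intro that[of "n - 3"]) linarith
      show ?thesis unfolding n
      proof (rule full_end_cycle[OF path f p])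
        fix h' z x d
        assume "set h \<subseteq> set h'" "green_path h' (p # z # f # xs)" "full h' p" "d \<noteq> Green"
          "touched h' d x" "x \<notin> verts h" "z \<notin> verts h" "x \<notin> set (p # z # f # xs)"
        thus "forced_win l m h'"
          by (intro D[of m h' p "z # f # xs" x p'])
             (use n K p' half_in_verts[OF p'(1)] in \<open>auto intro: touched_imp_half half_subset\<close>)
      next
        fix h' x y
        assume *: "set h \<subseteq> set h'" "green_path h' (y # p # x # f # xs)" "x \<notin> verts h" "y \<notin> verts h"
          and "\<And>v. drawn h' y v \<Longrightarrow> v = p"
        \<comment> \<open>The new end \<open>y\<close> is adjacent to \<open>p\<close> only, so the
          edge from \<open>y\<close> to \<open>p'\<close> is still available, as \<open>?C\<close>
          demands.\<close>
        hence "\<not> drawn h' y p'" using p' by auto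
        thus "forced_win l m h'"
          by (intro C[of m h' y "p # x # f # xs" p'])
             (use * n K p' half_in_verts[OF p'(1)] in \<open>auto intro: half_subset\<close>)
      qed
    qed
  qed
  moreover have "?C n"
  proof (intro allI impI)
    fix h q xs p assume path: "green_path h (q # xs)" and p: "half h p" "p \<notin> set (q # xs)"
      and undrawn: "\<not> drawn h q p" and K: "3 * l + 2 \<le> 2 * n + 3 * length (q # xs)"
    show "forced_win l n h"
    proof (cases "l \<le> length (q # xs)")
      case True thus ?thesis using path forced_win_green_path by blast
    next
      case False
      then obtain m where n: "n = Suc (Suc (Suc m))"
        using K by (intro that[of "n - 3"]) linarith
      obtain y where y: "y \<notin> insert p (set (q # xs))" "y \<notin> verts h"
        by (rule obtain_fresh[of "insert p (set (q # xs))" h]) simp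
      obtain z where z: "z \<notin> insert y (insert p (set (q # xs)))" "z \<notin> verts h"
        by (rule obtain_fresh[of "insert y (insert p (set (q # xs)))" h]) simp
      note simps = y z not_drawn[OF y(2)] not_drawn[OF z(2)] path p undrawn drawn_sym[of h q p]
      show ?thesis unfolding n
      proof (rule draw_at_half[of _ p q])
        show "forced_win l (Suc (Suc m)) (({p, q}, Green) # h)"
          by (rule W[of _ _ "p # q # xs"]) (use simps n K in auto)
        fix c let ?h = "({p, q}, c) # h"
        assume full: "full ?h p" and half: "half ?h q"
        show "forced_win l (Suc (Suc m)) ?h"
        proof (rule draw_at_half[of _ q y])
          let ?h' = "({q, y}, Green) # ?h"
          show "forced_win l (Suc m) ?h'"
          \<comment> \<open>The slack bound guarantees only three rounds for this branch, which uses
            four. If the fourth is missing, the path is already long enough here.\<close>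
          proof (cases "l \<le> length (y # q # xs)")
            case True thus ?thesis
              by (intro forced_win_green_path[of _ "y # q # xs"]) (use simps in auto)
          next
            case False
            then obtain k where m: "m = Suc k" using K n by (cases m) auto
            let ?h'' = "({p, y}, Green) # ?h'" and ?h3 = "({p, z}, Green) # ({p, y}, Green) # ?h'"
            show ?thesis
            proof (rule draw_at_full[of _ p y])
              show "forced_win l m ?h''" unfolding m
              proof (rule draw_at_full[of _ p z])
                show "forced_win l k ?h3"
                  by (rule W[of _ _ "z # p # y # q # xs"]) (use simps n m K in auto)
              qed (use simps full in auto)
            qed (use simps full in auto)
          qed
        next
          fix d let ?h' = "({q, y}, d) # ?h"
          assume q: "full ?h' q" and hy: "half ?h' y"
          show "forced_win l (Suc m) ?h'"
          proof (rule draw_at_full[of _ q z])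
            let ?h'' = "({q, z}, Green) # ?h'"
            show "forced_win l m ?h''"
            proof (cases "l \<le> length (z # q # xs)")
              case True thus ?thesis
                by (intro forced_win_green_path[of _ "z # q # xs"]) (use simps in auto)
            next
              case False
              then obtain k where m: "m = Suc k" using K n by (cases m) auto
              show ?thesis unfolding m
              proof (rule draw_at_full[of _ p z])
                show "forced_win l k (({p, z}, Green) # ?h'')"
                  by (rule A[of _ _ p "z # q # xs" y]) (use simps n m K full hy in auto)
              qed (use simps full in auto)
            qed
          qed (use simps q in auto)
        qed (use simps half in auto)
      qed (use simps in auto)
    qed
  qed
  ultimately show ?case by blast
qed

lemmas any_path_wins = states_win[THEN conjunct1, rule_format]

lemmas full_end_wins = states_win[THEN conjunct2, THEN conjunct1, rule_format]

section \<open>Winning positions that exploit both ends of the path\<close>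

lemma rev_eq_last_Cons: "xs \<noteq> [] \<Longrightarrow> rev xs = last xs # rev (butlast xs)"
  by (induction xs rule: rev_induct) auto

lemma green_path_from_last:
  assumes "green_path h xs" "xs \<noteq> []"
  obtains ys where "green_path h (last xs # ys)" "set (last xs # ys) = set xs"
    "length (last xs # ys) = length xs"
proof (rule that[of "rev (butlast xs)"])
  note eq = rev_eq_last_Cons[OF assms(2), symmetric]
  show "green_path h (last xs # rev (butlast xs))" unfolding eq using assms(1) by simp
  show "set (last xs # rev (butlast xs)) = set xs" unfolding eq by simp
  show "length (last xs # rev (butlast xs)) = length xs" unfolding eq by simp
qed

lemma full_last_wins:
  assumes "green_path h xs" "xs \<noteq> []" "full h (last xs)" "half h p" "p \<notin> set xs"
    "3 * l \<le> 2 * n + 3 * length xs"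
  shows "forced_win l n h"
proof -
  obtain ys where ys: "green_path h (last xs # ys)" "set (last xs # ys) = set xs"
    "length (last xs # ys) = length xs"
    using green_path_from_last[OF assms(1,2)] .
  show ?thesis
    by (rule full_end_wins[OF ys(1) assms(3,4)]) (simp_all only: ys assms not_False_eq_True)
qed

text \<open>A half end lowers the required slack from 3 to 2: a green answer to \<open>u x\<close>
  yields slack 3, any other makes \<open>u\<close> full and \<open>x\<close> a half vertex off the
  path, with slack 0.\<close>

lemma half_end_wins:
  assumes path: "green_path h (u # xs)" and u: "half h u"
    and K: "3 * l + 2 \<le> 2 * n + 3 * length (u # xs)"
  shows "forced_win l n h"
proof (cases "l \<le> length (u # xs)")
  case True thus ?thesis using path forced_win_green_path by blast
next
  case False
  then obtain m where n: "n = Suc m" using K by (cases n) auto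
  obtain x where x: "x \<notin> set (u # xs)" "x \<notin> verts h"
    by (rule obtain_fresh[of "set (u # xs)" h]) simp
  note simps = x not_drawn[OF x(2)] path
  show ?thesis unfolding n
  proof (rule draw_at_half[of _ u x])
    show "forced_win l m (({u, x}, Green) # h)"
      by (rule any_path_wins[of _ "x # u # xs"]) (use simps n K in auto)
    fix c let ?h = "({u, x}, c) # h"
    assume "full ?h u" "half ?h x"
    thus "forced_win l m ?h"
      by (intro full_end_wins[of ?h u xs x]) (use simps n K in auto)
  qed (use simps u in auto)
qed

lemma half_last_wins:
  assumes "green_path h xs" "xs \<noteq> []" "half h (last xs)" "3 * l + 2 \<le> 2 * n + 3 * length xs"
  shows "forced_win l n h"
proof -
  obtain ys where ys: "green_path h (last xs # ys)" "length (last xs # ys) = length xs"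
    using green_path_from_last[OF assms(1,2)] .
  show ?thesis
    by (rule half_end_wins[OF ys(1) assms(3)]) (simp only: ys assms)
qed

text \<open>Slack -1. \<open>full_end_cycle\<close> does not disturb the far end, so its first
  outcome reproduces the position, while its second has slack 2 and a half end.\<close>

lemma full_end_half_last_wins:
  assumes "green_path h (f # xs)" "full h f" "half h p" "p \<notin> set (f # xs)"
    "half h (last (f # xs))" "3 * l \<le> 2 * n + 3 * length (f # xs) + 1"
  shows "forced_win l n h"
  using assms
proof (induction n arbitrary: h f xs p rule: less_induct)
  case (less n)
  note path = less.prems(1) and f = less.prems(2) and p = less.prems(3,4) and e = less.prems(5)
    and K = less.prems(6)
  consider "l \<le> length (f # xs)" | "l = Suc (length (f # xs))" | "l \<ge> Suc (Suc (length (f # xs)))"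
    by linarith
  thus ?case
  proof cases
    case 1 thus ?thesis using path forced_win_green_path by blast
  next
    case 2
    then obtain m where "n = Suc m" using K by (cases n) auto
    thus ?thesis using extend_at_full[OF path f] 2 by simp
  next
    case 3
    then obtain m where n: "n = m + 3" using K by (intro that[of "n - 3"]) linarith
    show ?thesis unfolding n
    proof (rule full_end_cycle[OF path f p])
      fix h' z x d
      assume "set h \<subseteq> set h'" "green_path h' (p # z # f # xs)" "full h' p" "d \<noteq> Green"
        "touched h' d x" "x \<notin> set (p # z # f # xs)"
      thus "forced_win l m h'"
        by (intro less.IH[of m h' p "z # f # xs" x])
           (use n K e in \<open>auto intro: touched_imp_half half_subset\<close>)
    next
      fix h' x y assume "set h \<subseteq> set h'" "green_path h' (y # p # x # f # xs)"
      thus "forced_win l m h'"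
        by (intro half_last_wins[of h' "y # p # x # f # xs"])
           (use n K e in \<open>auto intro: half_subset\<close>)
    qed
  qed
qed

text \<open>Slack 1. Drawing \<open>u x\<close> leads to slack 2 with a half far end, or to a full
  end with slack -1.\<close>

lemma half_ends_win:
  assumes path: "green_path h (u # xs)" and u: "half h u" and e: "half h (last (u # xs))"
    and K: "3 * l + 1 \<le> 2 * n + 3 * length (u # xs)"
  shows "forced_win l n h"
proof (cases "l \<le> length (u # xs)")
  case True thus ?thesis using path forced_win_green_path by blast
next
  case False
  then obtain m where n: "n = Suc m" using K by (cases n) auto
  obtain x where x: "x \<notin> set (u # xs)" "x \<notin> verts h"
    by (rule obtain_fresh[of "set (u # xs)" h]) simp
  note simps = x not_drawn[OF x(2)] path
  show ?thesis unfolding n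
  proof (rule draw_at_half[of _ u x])
    show "forced_win l m (({u, x}, Green) # h)"
      by (rule half_last_wins[of _ "x # u # xs"]) (use simps n K e in auto)
    fix c let ?h = "({u, x}, c) # h"
    assume "full ?h u" "half ?h x"
    thus "forced_win l m ?h"
      by (intro full_end_half_last_wins[of ?h u xs x]) (use simps n K e in auto)
  qed (use simps u in auto)
qed

text \<open>The moves are those of \<open>?C\<close> in \<open>states_win\<close>; the half far end
  saves one unit of slack at each leaf. The bound on \<open>length (q # xs)\<close> ensures that
  four rounds remain.\<close>

lemma half_off_half_last_wins:
  assumes path: "green_path h (q # xs)" and p: "half h p" "p \<notin> set (q # xs)"
    and undrawn: "\<not> drawn h q p" and e: "half h (last (q # xs))"
    and r: "Suc (length (q # xs)) < l" and K: "3 * l + 1 \<le> 2 * n + 3 * length (q # xs)"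
  shows "forced_win l n h"
proof -
  obtain m where n: "n = Suc (Suc (Suc (Suc m)))"
    using K r by (intro that[of "n - 4"]) linarith
  obtain y where y: "y \<notin> insert p (set (q # xs))" "y \<notin> verts h"
    by (rule obtain_fresh[of "insert p (set (q # xs))" h]) simp
  obtain z where z: "z \<notin> insert y (insert p (set (q # xs)))" "z \<notin> verts h"
    by (rule obtain_fresh[of "insert y (insert p (set (q # xs)))" h]) simp
  note simps = y z not_drawn[OF y(2)] not_drawn[OF z(2)] path p undrawn drawn_sym[of h q p]
  show ?thesis unfolding n
  proof (rule draw_at_half[of _ p q])
    show "forced_win l (Suc (Suc (Suc m))) (({p, q}, Green) # h)"
      by (rule half_end_wins[of _ p "q # xs"]) (use simps n K in auto)
    fix c let ?h = "({p, q}, c) # h"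
    assume full: "full ?h p" and half: "half ?h q"
    show "forced_win l (Suc (Suc (Suc m))) ?h"
    proof (rule draw_at_half[of _ q y])
      let ?h' = "({q, y}, Green) # ?h"
      let ?h'' = "({p, y}, Green) # ?h'" and ?h3 = "({p, z}, Green) # ({p, y}, Green) # ?h'"
      show "forced_win l (Suc (Suc m)) ?h'"
      proof (rule draw_at_full[of _ p y])
        show "forced_win l (Suc m) ?h''"
        proof (rule draw_at_full[of _ p z])
          show "forced_win l m ?h3"
            by (rule half_last_wins[of _ "z # p # y # q # xs"]) (use simps n K e in auto)
        qed (use simps full in auto)
      qed (use simps full in auto)
    next
      fix d let ?h' = "({q, y}, d) # ?h" and ?h'' = "({q, z}, Green) # ({q, y}, d) # ?h"
      assume q: "full ?h' q" and hy: "half ?h' y"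
      show "forced_win l (Suc (Suc m)) ?h'"
      proof (rule draw_at_full[of _ q z])
        show "forced_win l (Suc m) ?h''"
        proof (rule draw_at_full[of _ p z])
          show "forced_win l m (({p, z}, Green) # ?h'')"
            by (rule full_end_half_last_wins[of _ p "z # q # xs" y])
               (use simps n K full hy e in auto)
        qed (use simps full in auto)
      qed (use simps q in auto)
    qed (use simps half in auto)
  qed (use simps in auto)
qed

text \<open>Slack -2. The vertex \<open>p'\<close> is kept in reserve while
  \<open>full_end_cycle\<close> is repeated. When its second outcome occurs, the path is continued
  from the far full end, with \<open>p'\<close> as the half vertex off the path.\<close>

lemma full_ends_win:
  assumes "green_path h (f # xs)" "full h f" "full h (last (f # xs))" "half h p" "p \<notin> set (f # xs)"
    "half h p'" "p' \<notin> set (f # xs)" "p \<noteq> p'" "3 * l \<le> 2 * n + 3 * length (f # xs) + 2"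
  shows "forced_win l n h"
  using assms
proof (induction n arbitrary: h f xs p rule: less_induct)
  case (less n)
  note path = less.prems(1) and f = less.prems(2) and e = less.prems(3) and p = less.prems(4,5)
    and p' = less.prems(6-8) and K = less.prems(9)
  consider "l \<le> length (f # xs)" | "l = Suc (length (f # xs))" | "l = Suc (Suc (length (f # xs)))"
    | "l \<ge> Suc (Suc (Suc (length (f # xs))))"
    by linarith
  thus ?case
  proof cases
    case 1 thus ?thesis using path forced_win_green_path by blast
  next
    case 2
    then obtain m where "n = Suc m" using K by (cases n) auto
    thus ?thesis using extend_at_full[OF path f] 2 by simp
  next
    case 3
    \<comment> \<open>There may be only two rounds left, too few for \<open>full_end_cycle\<close>;
      each full end receives one new vertex instead.\<close>
    then obtain m where n: "n = Suc (Suc m)" using K by (intro that[of "n - 2"]) simp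
    obtain z where z: "z \<notin> set (f # xs)" "z \<notin> verts h"
      by (rule obtain_fresh[of "set (f # xs)" h]) simp
    let ?h = "({f, z}, Green) # h"
    have "green_path ?h (z # f # xs)" using path z by auto
    then obtain ys where path': "green_path ?h (last (z # f # xs) # ys)"
      and len: "length (last (z # f # xs) # ys) = length (z # f # xs)"
      using green_path_from_last[of ?h "z # f # xs"] by auto
    have e': "full ?h (last (z # f # xs))" using e by simp
    have "forced_win l (Suc m) ?h"
      by (rule extend_at_full[OF path' e']) (use len 3 in simp)
    show ?thesis unfolding n
      by (rule draw_at_full[of _ f z]) (use f z not_drawn[OF z(2)] \<open>forced_win l (Suc m) ?h\<close> in auto)
  next
    case 4
    then obtain m where n: "n = m + 3" using K by (intro that[of "n - 3"]) simp
    show ?thesis unfolding n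
    proof (rule full_end_cycle[OF path f p])
      fix h' z x d
      assume "set h \<subseteq> set h'" "green_path h' (p # z # f # xs)" "full h' p" "d \<noteq> Green"
        "touched h' d x" "x \<notin> verts h" "z \<notin> verts h" "x \<notin> set (p # z # f # xs)"
      thus "forced_win l m h'"
        by (intro less.IH[of m h' p "z # f # xs" x])
           (use n K p' e half_in_verts[OF p'(1)] in
             \<open>auto intro: touched_imp_half half_subset full_subset\<close>)
    next
      fix h' x y
      assume "set h \<subseteq> set h'" "green_path h' (y # p # x # f # xs)" "x \<notin> verts h" "y \<notin> verts h"
      thus "forced_win l m h'"
        by (intro full_last_wins[of h' "y # p # x # f # xs" p'])
           (use n K p' e half_in_verts[OF p'(1)] in \<open>auto intro: half_subset full_subset\<close>)
    qed
  qed
qed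

section \<open>The parity argument for multiples of 4\<close>

text \<open>One unit less slack than in \<open>full_ends_win\<close>. The mod 4 condition records the parity of the
  alternating red-blue path from \<open>p\<close> to \<open>p'\<close>: three vertices before the end its end edges have
  different colors, so that \<open>p p'\<close> is forced to be green and both vertices join the path.\<close>

lemma full_ends_win_mod_4:
  assumes "green_path h (f # xs)" "full h f" "full h (last (f # xs))"
    "touched h c p" "c \<noteq> Green" "p \<notin> set (f # xs)"
    "touched h c' p'" "c' \<noteq> Green" "p' \<notin> set (f # xs)" "p \<noteq> p'"
    "4 dvd l" "length (f # xs) mod 4 = (if c = c' then 3 else 1)" "length (f # xs) + 3 \<le> l"
    "length (f # xs) + 3 = l \<Longrightarrow> \<not> drawn h p p' \<and> \<not> drawn h p (last (f # xs))"
    "3 * l \<le> 2 * n + 3 * length (f # xs) + 3"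
  shows "forced_win l n h"
  using assms
proof (induction n arbitrary: h f xs p c rule: less_induct)
  case (less n)
  note path = less.prems(1) and f = less.prems(2) and e = less.prems(3) and p = less.prems(4-6)
    and p' = less.prems(7-10) and l = less.prems(11-13) and undrawn = less.prems(14)
    and K = less.prems(15)
  have hp: "half h p" and hp': "half h p'"
    using p p' by (auto intro: touched_imp_half)
  show ?case
  proof (cases "length (f # xs) + 3 = l")
    case True
    then obtain m where n: "n = Suc (Suc (Suc m))" using K by (intro that[of "n - 3"]) simp
    \<comment> \<open>Equal colors would mean a length congruent to 3, hence \<open>l\<close>
      congruent to 2 modulo 4.\<close>
    have "c \<noteq> c'"
    proof
      assume "c = c'"
      with l(2) have "l mod 4 = (3 + 3) mod 4"
        unfolding True[symmetric] by (metis mod_add_left_eq)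
      with l(1) show False by presburger
    qed
    hence colors: "c = Red \<and> c' = Blue \<or> c = Blue \<and> c' = Red"
      using p(2) p'(2) by (auto dest!: color_cases)
    let ?e = "last (f # xs)"
    let ?h = "({?e, p}, Green) # h"
    let ?h' = "({p, p'}, Green) # ?h"
    have e_in: "?e \<in> set (f # xs)" by (rule last_in_set) simp
    define ys where "ys = rev (butlast (f # xs))"
    have ys: "rev (f # xs) = ?e # ys"
      unfolding ys_def by (rule rev_eq_last_Cons) simp
    have "set (?e # ys) = set (f # xs)" unfolding ys[symmetric] by simp
    moreover have "green_path h (?e # ys)" unfolding ys[symmetric] green_path_rev by (rule path)
    ultimately have "green_path ?h' (p' # p # ?e # ys)"
      using p p' by auto
    also have "p' # p # ?e # ys = rev (f # xs @ [p, p'])"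
      using ys by simp
    finally have path': "green_path ?h' (f # xs @ [p, p'])"
      unfolding green_path_rev .
    have nd: "\<not> drawn h p p'" "\<not> drawn h ?e p"
      using undrawn[OF True] drawn_sym[of h ?e p] by auto
    show ?thesis unfolding n
    \<comment> \<open>Three forced green edges add three vertices: \<open>p\<close> and then
      \<open>p'\<close> beyond the far end, and a fresh one at \<open>f\<close>.\<close>
    proof (rule draw_at_full[of _ ?e p])
      show "forced_win l (Suc (Suc m)) ?h"
      proof (rule draw_forced[of p p'])
        show "forced_win l (Suc m) ?h'"
          by (rule extend_at_full[OF path']) (use f True in auto)
      qed (use nd p p' colors e_in in auto)
    qed (use nd p e e_in in auto)
  next
    case False
    \<comment> \<open>The path has an odd number of vertices and \<open>l\<close> is even, so the
      difference cannot be 4. The next cycle therefore does not overshoot the length at which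
      \<open>p p'\<close> is drawn.\<close>
    have len: "length (f # xs) + 5 \<le> l"
    proof -
      have "length (f # xs) mod 4 = 1 \<or> length (f # xs) mod 4 = 3" using l(2) by (auto split: if_splits)
      with False l(1,3) show ?thesis by presburger
    qed
    then obtain m where n: "n = m + 3" using K by (intro that[of "n - 3"]) simp
    show ?thesis unfolding n
    proof (rule full_end_cycle[OF path f hp p(3)])
      fix h' z x d
      assume *: "set h \<subseteq> set h'" "green_path h' (p # z # f # xs)" "full h' p" "d \<noteq> Green"
        "touched h' d x" "\<not> touched h d p" "x \<notin> verts h" "z \<notin> verts h" "x \<notin> set (p # z # f # xs)"
        and adj: "\<And>v. drawn h' x v \<Longrightarrow> v = p"
      \<comment> \<open>The edge \<open>p x\<close> continues the alternating path, so the color at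
        the loose end switches exactly when the length grows by 2; this preserves the mod 4
        condition.\<close>
      have "d \<noteq> c" using *(6) p(1) by auto
      hence "d = c' \<longleftrightarrow> c \<noteq> c'" using *(4) p(2) p'(2) by (auto dest!: color_cases)
      hence mod4: "length (p # z # f # xs) mod 4 = (if d = c' then 3 else 1)"
        using l(2) by (auto split: if_splits) presburger+
      show "forced_win l m h'"
      proof (rule less.IH[of m h' p "z # f # xs" d x])
        have "last (f # xs) \<noteq> p" using p(3) last_in_set[of "f # xs"] by auto
        thus "\<not> drawn h' x p' \<and> \<not> drawn h' x (last (p # z # f # xs))"
          using adj p'(4) by auto
      qed (use * mod4 n K p' e l len half_in_verts[OF hp'] in \<open>auto intro: touched_subset full_subset\<close>)
    next
      fix h' x y
      assume "set h \<subseteq> set h'" "green_path h' (y # p # x # f # xs)" "x \<notin> verts h" "y \<notin> verts h"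
      thus "forced_win l m h'"
        by (intro full_last_wins[of h' "y # p # x # f # xs" p'])
           (use n K p' e hp' half_in_verts[OF hp'] in \<open>auto intro: half_subset full_subset\<close>)
    qed
  qed
qed

section \<open>A red or blue edge and a green edge with a common vertex\<close>

lemma full_iff_touched:
  assumes "c \<noteq> Green" "d \<noteq> Green" "c \<noteq> d"
  shows "full h x \<longleftrightarrow> touched h c x \<and> touched h d x"
    and "half h x \<longleftrightarrow> touched h c x \<or> touched h d x"
  using assms by (auto simp: full_def half_def dest!: color_cases)

lemma draw_forced_colors:
  assumes "c \<noteq> Green" "d \<noteq> Green" "c \<noteq> d" "u \<noteq> v" "\<not> drawn h u v"
    and "touched h c u \<or> touched h c v" "touched h d u \<or> touched h d v"
    and "forced_win l n (({u, v}, Green) # h)"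
  shows "forced_win l (Suc n) h"
  using assms by (intro draw_forced[of u v]) (auto dest!: color_cases)

text \<open>Calling the two colors \<open>c\<close> and \<open>d\<close> lets the case tree of
  \<open>fork_wins\<close> cover both colorings of the first edge at once.\<close>

lemma draw_two_colors:
  assumes "c \<noteq> Green" "d \<noteq> Green" "c \<noteq> d" "u \<noteq> v" "\<not> drawn h u v"
    and "\<not> (touched h c u \<or> touched h c v) \<Longrightarrow> forced_win l n (({u, v}, c) # h)"
    and "\<not> (touched h d u \<or> touched h d v) \<Longrightarrow> forced_win l n (({u, v}, d) # h)"
    and "forced_win l n (({u, v}, Green) # h)"
  shows "forced_win l (Suc n) h"
proof (rule forced_win_step[of u v])
  fix c' assume "c' \<noteq> Green" "\<not> touched h c' u" "\<not> touched h c' v"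
  moreover from this(1) have "c' = c \<or> c' = d"
    using assms(1-3) by (auto dest!: color_cases)
  ultimately show "forced_win l n (({u, v}, c') # h)"
    using assms(6,7) by auto
qed (use assms in auto)

text \<open>Growing at \<open>v1\<close> is too slow if Painter answers green there; drawing \<open>v3 v4\<close> apart from the fork
  works for each of the three answers. The case tree comes from an exhaustive search.\<close>

lemma fork_wins:
  assumes dist: "distinct [v0, v1, v2]" and c: "c \<noteq> Green"
    and red: "touched h c v0" "touched h c v1" and gr: "green h v0 v2"
    and edges: "\<And>x y. drawn h x y \<longleftrightarrow> {x, y} = {v0, v1} \<or> {x, y} = {v0, v2}"
    and l: "8 \<le> l" and K: "3 * l \<le> 2 * n + 6"
  shows "forced_win l n h"
proof -
  obtain d where d: "d \<noteq> Green" "c \<noteq> d" by (metis color.distinct)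
  obtain m where n: "n = Suc (Suc (Suc (Suc (Suc m))))"
    using l K by (intro that[of "n - 5"]) simp
  obtain v3 v4 v5 where fresh: "distinct [v3, v4, v5]" "{v3, v4, v5} \<inter> {v0, v1, v2} = {}"
  proof -
    obtain v3 where "v3 \<notin> {v0, v1, v2}" by (rule obtain_fresh[of "{v0, v1, v2}" "[]"]) auto
    moreover obtain v4 where "v4 \<notin> {v0, v1, v2, v3}"
      by (rule obtain_fresh[of "{v0, v1, v2, v3}" "[]"]) auto
    moreover obtain v5 where "v5 \<notin> {v0, v1, v2, v3, v4}"
      by (rule obtain_fresh[of "{v0, v1, v2, v3, v4}" "[]"]) auto
    ultimately show ?thesis by (intro that[of v3 v4 v5]) auto
  qed
  have ne: "v0 \<noteq> v1" "v0 \<noteq> v2" "v1 \<noteq> v2" "v3 \<noteq> v4" "v3 \<noteq> v5" "v4 \<noteq> v5"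
    "v0 \<noteq> v3" "v0 \<noteq> v4" "v0 \<noteq> v5" "v1 \<noteq> v3" "v1 \<noteq> v4" "v1 \<noteq> v5" "v2 \<noteq> v3" "v2 \<noteq> v4" "v2 \<noteq> v5"
    using dist fresh by auto
  note ne = ne ne[symmetric] c d d(2)[symmetric]
  have gr': "green h v2 v0" using gr by (simp add: green_sym)
  note touch_iff = full_iff_touched[OF c d]
  note simps = ne edges doubleton_eq_iff red gr gr' touch_iff
  \<comment> \<open>The path \<open>v2 v0\<close> has slack at least 0, and no branch exceeds five
    rounds. The leaves have five path vertices and slack -1, 1 or 3 after five, four or three
    rounds, and in one case six vertices and slack 2 after five; each slack is what the lemma
    applied there requires.\<close>
  show ?thesis unfolding n
  proof (rule draw_two_colors[OF c d, of v3 v4])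
    let ?h1 = "({v3, v4}, c) # h"
    show "forced_win l (Suc (Suc (Suc (Suc m)))) ?h1"
    proof (rule draw_two_colors[OF c d, of v1 v5])
      let ?h2 = "({v1, v5}, d) # ?h1"
      show "forced_win l (Suc (Suc (Suc m))) ?h2"
      proof (rule draw_forced_colors[OF c d, of v0 v5])
        let ?h3 = "({v0, v5}, Green) # ?h2"
        show "forced_win l (Suc (Suc m)) ?h3"
        proof (rule draw_forced_colors[OF c d, of v1 v2])
          let ?h4 = "({v1, v2}, Green) # ?h3"
          show "forced_win l (Suc m) ?h4"
          proof (rule draw_forced_colors[OF c d, of v3 v5])
            let ?h5 = "({v3, v5}, Green) # ?h4"
            show "forced_win l m ?h5"
            by (rule full_end_half_last_wins[of _ v1 "[v2, v0, v5, v3]" v4]) (use simps n K l in auto)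
          qed (use simps in auto)
        qed (use simps in auto)
      qed (use simps in auto)
    next
      let ?h2 = "({v1, v5}, Green) # ?h1"
      show "forced_win l (Suc (Suc (Suc m))) ?h2"
      proof (rule draw_two_colors[OF c d, of v2 v3])
        let ?h3 = "({v2, v3}, d) # ?h2"
        show "forced_win l (Suc (Suc m)) ?h3"
        proof (rule draw_forced_colors[OF c d, of v1 v2])
          let ?h4 = "({v1, v2}, Green) # ?h3"
          show "forced_win l (Suc m) ?h4"
          proof (rule draw_forced_colors[OF c d, of v3 v5])
            let ?h5 = "({v3, v5}, Green) # ?h4"
            show "forced_win l m ?h5"
            by (rule full_end_half_last_wins[of _ v3 "[v5, v1, v2, v0]" v4]) (use simps n K l in auto)
          qed (use simps in auto)
        qed (use simps in auto)
      next
        let ?h3 = "({v2, v3}, Green) # ?h2"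
        show "forced_win l (Suc (Suc m)) ?h3"
        proof (rule draw_two_colors[OF c d, of v0 v5])
          let ?h4 = "({v0, v5}, d) # ?h3"
          show "forced_win l (Suc m) ?h4"
          proof (rule draw_forced_colors[OF c d, of v3 v5])
            let ?h5 = "({v3, v5}, Green) # ?h4"
            show "forced_win l m ?h5"
            by (rule full_end_half_last_wins[of _ v0 "[v2, v3, v5, v1]" v4]) (use simps n K l in auto)
          qed (use simps in auto)
        next
          let ?h4 = "({v0, v5}, Green) # ?h3"
          show "forced_win l (Suc m) ?h4"
          by (rule half_ends_win[of _ v1 "[v5, v0, v2, v3]"]) (use simps n K l in auto)
        qed (use simps in auto)
      qed (use simps in auto)
    qed (use simps in auto)
  next
    let ?h1 = "({v3, v4}, d) # h"
    show "forced_win l (Suc (Suc (Suc (Suc m)))) ?h1"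
    proof (rule draw_two_colors[OF c d, of v3 v5])
      let ?h2 = "({v3, v5}, c) # ?h1"
      show "forced_win l (Suc (Suc (Suc m))) ?h2"
      proof (rule draw_forced_colors[OF c d, of v0 v4])
        let ?h3 = "({v0, v4}, Green) # ?h2"
        show "forced_win l (Suc (Suc m)) ?h3"
        proof (rule draw_forced_colors[OF c d, of v1 v4])
          let ?h4 = "({v1, v4}, Green) # ?h3"
          show "forced_win l (Suc m) ?h4"
          proof (rule draw_forced_colors[OF c d, of v2 v3])
            let ?h5 = "({v2, v3}, Green) # ?h4"
            show "forced_win l m ?h5"
            by (rule full_end_half_last_wins[of _ v3 "[v2, v0, v4, v1]" v5]) (use simps n K l in auto)
          qed (use simps in auto)
        qed (use simps in auto)
      qed (use simps in auto)
    next
      let ?h2 = "({v3, v5}, Green) # ?h1"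
      show "forced_win l (Suc (Suc (Suc m))) ?h2"
      proof (rule draw_forced_colors[OF c d, of v0 v3])
        let ?h3 = "({v0, v3}, Green) # ?h2"
        show "forced_win l (Suc (Suc m)) ?h3"
        proof (rule draw_two_colors[OF c d, of v1 v2])
          let ?h4 = "({v1, v2}, d) # ?h3"
          show "forced_win l (Suc m) ?h4"
          proof (rule draw_forced_colors[OF c d, of v1 v5])
            let ?h5 = "({v1, v5}, Green) # ?h4"
            show "forced_win l m ?h5"
            by (rule full_end_half_last_wins[of _ v1 "[v5, v3, v0, v2]" v4]) (use simps n K l in auto)
          qed (use simps in auto)
        next
          let ?h4 = "({v1, v2}, Green) # ?h3"
          show "forced_win l (Suc m) ?h4"
          by (rule half_off_half_last_wins[of _ v5 "[v3, v0, v2, v1]" v4]) (use simps n K l in auto)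
        qed (use simps in auto)
      qed (use simps in auto)
    qed (use simps in auto)
  next
    let ?h1 = "({v3, v4}, Green) # h"
    show "forced_win l (Suc (Suc (Suc (Suc m)))) ?h1"
    proof (rule draw_two_colors[OF c d, of v1 v2])
      let ?h2 = "({v1, v2}, d) # ?h1"
      show "forced_win l (Suc (Suc (Suc m))) ?h2"
      proof (rule draw_forced_colors[OF c d, of v1 v3])
        let ?h3 = "({v1, v3}, Green) # ?h2"
        show "forced_win l (Suc (Suc m)) ?h3"
        proof (rule draw_two_colors[OF c d, of v0 v5])
          let ?h4 = "({v0, v5}, d) # ?h3"
          show "forced_win l (Suc m) ?h4"
          proof (rule draw_forced_colors[OF c d, of v0 v4])
            let ?h5 = "({v0, v4}, Green) # ?h4"
            show "forced_win l m ?h5"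
            by (rule full_end_half_last_wins[of _ v1 "[v3, v4, v0, v2]" v5]) (use simps n K l in auto)
          qed (use simps in auto)
        next
          let ?h4 = "({v0, v5}, Green) # ?h3"
          show "forced_win l (Suc m) ?h4"
          proof (rule draw_forced_colors[OF c d, of v1 v5])
            let ?h5 = "({v1, v5}, Green) # ?h4"
            show "forced_win l m ?h5"
            by (rule half_end_wins[of _ v2 "[v0, v5, v1, v3, v4]"]) (use simps n K l in auto)
          qed (use simps in auto)
        qed (use simps in auto)
      qed (use simps in auto)
    next
      let ?h2 = "({v1, v2}, Green) # ?h1"
      show "forced_win l (Suc (Suc (Suc m))) ?h2"
      proof (rule draw_two_colors[OF c d, of v0 v3])
        let ?h3 = "({v0, v3}, d) # ?h2"
        show "forced_win l (Suc (Suc m)) ?h3"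
        proof (rule draw_forced_colors[OF c d, of v0 v4])
          let ?h4 = "({v0, v4}, Green) # ?h3"
          show "forced_win l (Suc m) ?h4"
          by (rule half_ends_win[of _ v1 "[v2, v0, v4, v3]"]) (use simps n K l in auto)
        qed (use simps in auto)
      next
        let ?h3 = "({v0, v3}, Green) # ?h2"
        show "forced_win l (Suc (Suc m)) ?h3"
        by (rule any_path_wins[of _ "[v1, v2, v0, v3, v4]"]) (use simps n K l in auto)
      qed (use simps in auto)
    qed (use simps in auto)
  qed (use simps in auto)
qed

section \<open>Builder's opening moves\<close>

lemma drawn_Nil [simp]: "\<not> drawn [] x y"
  by (simp add: drawn_def)

text \<open>A single vertex has slack 2 here. Drawing \<open>0 1\<close> and, unless the answer is
  green, \<open>1 2\<close> leads to slack 3 for any path, slack 1 with a half far end, or slack -2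
  with the full vertex 1 as both ends of its path.\<close>

lemma forced_win_odd:
  assumes "odd l" "3 \<le> l"
  shows "forced_win l (3 * l div 2) []"
proof -
  obtain m where m: "3 * l = 2 * m + 5"
    using assms by (intro that[of "3 * (l div 2) - 1"]) presburger
  hence n: "3 * l div 2 = Suc (Suc m)" by simp
  show ?thesis unfolding n
  proof (rule draw_any[of 0 1])
    show "forced_win l (Suc m) [({0, 1}, Green)]"
      by (rule any_path_wins[of _ "[1, 0]"]) (use m in auto)
    fix c let ?h = "[({0, 1}, c)] :: history"
    assume half: "half ?h 0" "half ?h 1"
    show "forced_win l (Suc m) ?h"
    proof (rule draw_at_half[of _ 1 2])
      let ?h' = "({1, 2}, Green) # ?h"
      show "forced_win l m ?h'"
      \<comment> \<open>\<open>half_off_half_last_wins\<close> needs at least two missing vertices,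
        whereas for \<open>l = 3\<close> only one is missing.\<close>
      proof (cases "l = 3")
        case True
        then obtain k where k: "m = Suc (Suc k)" using m by (intro that[of "m - 2"]) simp
        show ?thesis unfolding k
        proof (rule draw_at_half[of _ 1 3])
          show "forced_win l (Suc k) (({1, 3}, Green) # ?h')"
            by (rule forced_win_green_path[of _ "[3, 1, 2]"]) (use True in auto)
          fix d assume "full (({1, 3}, d) # ?h') 1"
          thus "forced_win l (Suc k) (({1, 3}, d) # ?h')"
            by (intro extend_at_full[of _ 1 "[2]"]) (use True in auto)
        qed (use half in auto)
      next
        case False
        hence "5 \<le> l" using assms by presburger
        thus ?thesis
          by (intro half_off_half_last_wins[of _ 2 "[1]" 0]) (use m half in auto)
      qed
      fix d let ?h' = "({1, 2}, d) # ?h"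
      assume "full ?h' 1" "half ?h' 2"
      thus "forced_win l m ?h'"
        by (intro full_ends_win[of _ 1 "[]" 0 2]) (use m half in auto)
    qed (use half in auto)
  qed auto
qed

text \<open>A single vertex has slack only 1 here. Two edges at 0 give a green path with slack 3, a
  fork, or a full vertex with slack -3, for which the parity argument is needed.\<close>

lemma forced_win_mod_4:
  assumes "4 dvd l" "8 \<le> l"
  shows "forced_win l (3 * l div 2 - 1) []"
proof -
  obtain m where m: "3 * l = 2 * m + 6"
    using assms by (intro that[of "3 * (l div 2) - 3"]) presburger
  hence n: "3 * l div 2 - 1 = Suc (Suc m)" by simp
  show ?thesis unfolding n
  proof (rule forced_win_step[of 0 1])
    fix c :: color assume c: "c \<noteq> Green"
    let ?h = "[({0, 1}, c)] :: history"
    show "forced_win l (Suc m) ?h"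
    proof (rule forced_win_step[of 0 2])
      show "forced_win l m (({0, 2}, Green) # ?h)"
        by (rule fork_wins[of 0 1 2 c]) (use assms m c in \<open>auto simp: doubleton_eq_iff\<close>)
      fix d assume d: "d \<noteq> Green" "\<not> touched ?h d 0"
      hence "d \<noteq> c" by simp
      thus "forced_win l m (({0, 2}, d) # ?h)"
        by (intro full_ends_win_mod_4[of _ 0 "[]" c 1 d 2])
           (use c d assms m in \<open>auto simp: full_iff_touched[of c d]\<close>)
    qed auto
  next
    let ?h = "[({0, 1}, Green)] :: history"
    show "forced_win l (Suc m) ?h"
    proof (rule forced_win_step[of 0 2])
      show "forced_win l m (({0, 2}, Green) # ?h)"
        by (rule any_path_wins[of _ "[2, 0, 1]"]) (use m in auto)
      fix c assume c: "c \<noteq> Green"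
      show "forced_win l m (({0, 2}, c) # ?h)"
        \<comment> \<open>The same fork, with the answers to the two edges interchanged.\<close>
        by (rule fork_wins[of 0 2 1 c]) (use assms m c in \<open>auto simp: doubleton_eq_iff\<close>)
    qed auto
  qed auto
qed

definition rounds :: "nat \<Rightarrow> nat" where
  "rounds l = (if l mod 4 = 0 \<and> l \<ge> 8 then 3 * l div 2 - 1 else 3 * l div 2)"

lemma forced_win_rounds:
  assumes "2 \<le> l"
  shows "forced_win l (rounds l) []"
proof -
  consider "odd l" | "l mod 4 = 0" "8 \<le> l" | "even l" "\<not> (l mod 4 = 0 \<and> 8 \<le> l)"
    by (cases "odd l"; cases "l mod 4 = 0 \<and> 8 \<le> l") auto
  thus ?thesis
  proof cases
    case 1
    hence "l mod 4 \<noteq> 0" by presburger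
    thus ?thesis using forced_win_odd[of l] 1 assms by (cases "l = 2") (auto simp: rounds_def)
  next
    case 2 thus ?thesis using forced_win_mod_4[of l] by (simp add: rounds_def mod_eq_0_iff_dvd)
  next
    case 3
    \<comment> \<open>Hence a single vertex already has slack exactly 3.\<close>
    hence "2 * rounds l = 3 * l" unfolding rounds_def by (simp only: if_False) simp
    thus ?thesis by (intro any_path_wins[of _ "[0]"]) simp_all
  qed
qed

section \<open>From forced wins to strategies\<close>

text \<open>Builder plays an edge after which the recursion still promises a win; the length of the
  history tells how many rounds remain. By induction, the promise survives against every Painter
  until no round is left, where it is a win.\<close>

lemma builder_wins_within_if_forced_win:
  assumes "forced_win l n []"
  shows "builder_wins_within (path_graph 3) (path_graph 3) (path_graph l) n"
proof -
  define good where "good h u v \<longleftrightarrow> u \<noteq> v \<and> \<not> drawn h u v \<and>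
    (\<forall>c. forced_win l (n - Suc (length h)) (({u, v}, c) # h))" for h :: history and u v
  \<comment> \<open>Legality is demanded after every history, so where no good edge exists an
    arbitrary undrawn one is chosen.\<close>
  have "\<exists>u v. u \<noteq> v \<and> \<not> drawn h u v \<and> ((\<exists>u v. good h u v) \<longrightarrow> good h u v)" for h :: history
  proof (cases "\<exists>u v. good h u v")
    case True
    then obtain u v where "good h u v" by blast
    thus ?thesis unfolding good_def by blast
  next
    case False
    obtain x where x: "x \<notin> {}" "x \<notin> verts h" by (rule obtain_fresh[of "{}" h]) simp
    have "Suc x \<noteq> x" by simp
    thus ?thesis using not_drawn[OF x(2)] False by blast
  qed
  then obtain U V where UV: "U h \<noteq> V h" "\<not> drawn h (U h) (V h)"
    "(\<exists>u v. good h u v) \<Longrightarrow> good h (U h) (V h)" for h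
    by metis
  define \<sigma> where "\<sigma> h = {U h, V h}" for h
  have "legal_builder \<sigma>"
    using UV(1,2) unfolding legal_builder_def \<sigma>_def drawn_def by blast
  moreover have "\<exists>k\<le>n. won l (play \<sigma> \<tau> k)" for \<tau>
  proof (rule ccontr)
    assume never: "\<not> (\<exists>k\<le>n. won l (play \<sigma> \<tau> k))"
    have len: "length (play \<sigma> \<tau> k) = k" for k
      by (induction k) (auto simp: Let_def)
    have "k \<le> n \<Longrightarrow> forced_win l (n - k) (play \<sigma> \<tau> k)" for k
    proof (induction k)
      case 0 thus ?case using assms by simp
    next
      case (Suc k)
      let ?h = "play \<sigma> \<tau> k"
      have "forced_win l (Suc (n - Suc k)) ?h" using Suc by (simp add: Suc_diff_Suc)
      hence "\<exists>u v. good ?h u v" using never Suc.prems by (auto simp: good_def len)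
      from UV(3)[OF this]
      have "forced_win l (n - Suc k) (({U ?h, V ?h}, \<tau> ?h {U ?h, V ?h}) # ?h)"
        unfolding good_def len by blast
      thus ?case by (simp add: \<sigma>_def[of ?h] Let_def)
    qed
    from this[of n] never show False by auto
  qed
  ultimately show ?thesis unfolding builder_wins_within_def by blast
qed

subsection \<open>Painter\<close>

lemma color_class_Cons:
  "color_class ((e, c) # h) c' = (if c = c' then insert e (color_class h c') else color_class h c')"
  by (auto simp: color_class_def)

lemma color_class_subset: "color_class h c \<subseteq> fst ` set h"
  by (force simp: color_class_def)

lemma finite_color_class [simp]: "finite (color_class h c)"
  by (rule finite_subset[OF color_class_subset]) simp

definition legal_history :: "history \<Rightarrow> bool" where
  "legal_history h \<longleftrightarrow> distinct (map fst h) \<and> (\<forall>e \<in> fst ` set h. \<exists>u v. u \<noteq> v \<and> e = {u, v})"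

lemma legal_history_Cons [simp]:
  "legal_history ((e, c) # h) \<longleftrightarrow>
     legal_history h \<and> e \<notin> fst ` set h \<and> (\<exists>u v. u \<noteq> v \<and> e = {u, v})"
  by (auto simp: legal_history_def)

lemma legal_history_length:
  "legal_history h \<Longrightarrow>
     length h = card (color_class h Red) + card (color_class h Blue) + card (color_class h Green)"
proof (induction h)
  case Nil thus ?case by (simp add: color_class_def)
next
  case (Cons m h)
  obtain e c where m: "m = (e, c)" by (cases m)
  have "e \<notin> color_class h c'" for c'
    using Cons.prems color_class_subset[of h c'] by (auto simp: m)
  thus ?case using Cons by (cases c) (auto simp: m color_class_Cons)
qed

lemma color_class_disjoint:
  assumes "legal_history h" "e \<in> color_class h c" "e \<in> color_class h d"
  shows "c = d"
  using assms inj_onD[of fst "set h" "(e, c)" "(e, d)"]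
  by (auto simp: legal_history_def color_class_def distinct_map)

lemma color_class_edge:
  assumes "legal_history h" "e \<in> color_class h c"
  obtains u v where "u \<noteq> v" "e = {u, v}"
proof -
  have "e \<in> fst ` set h" using assms(2) color_class_subset[of h c] by auto
  thus ?thesis using assms(1) that unfolding legal_history_def by metis
qed

lemma play_legal:
  assumes "legal_builder \<sigma>"
  shows "legal_history (play \<sigma> \<tau> k)" and "length (play \<sigma> \<tau> k) = k"
proof -
  show "legal_history (play \<sigma> \<tau> k)"
  proof (induction k)
    case 0 thus ?case by (simp add: legal_history_def)
  next
    case (Suc k)
    have "\<exists>u v. u \<noteq> v \<and> \<sigma> (play \<sigma> \<tau> k) = {u, v} \<and> {u, v} \<notin> fst ` set (play \<sigma> \<tau> k)"
      using assms unfolding legal_builder_def by blast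
    thus ?case using Suc by (auto simp: Let_def)
  qed
  show "length (play \<sigma> \<tau> k) = k"
    by (induction k) (auto simp: Let_def)
qed

lemma no_cherry_in_matching:
  assumes "disjoint E"
  shows "\<not> contains_copy E (path_graph 3)"
proof
  assume "contains_copy E (path_graph 3)"
  then obtain f where f: "inj_on f {..<3::nat}" "\<forall>e\<in>{{i, Suc i} |i. Suc i < 3}. f ` e \<in> E"
    by (auto simp: contains_copy_def path_graph_def)
  have "f ` {0, Suc 0} \<in> E" "f ` {1, Suc 1} \<in> E"
    by (intro f(2)[rule_format], force)+
  moreover have "f 0 \<noteq> f 1" "f 0 \<noteq> f 2"
    using inj_on_eq_iff[OF f(1), of 0 1] inj_on_eq_iff[OF f(1), of 0 2] by simp_all
  moreover from this have "f ` {0, Suc 0} \<noteq> f ` {1, Suc 1}"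
    by (simp add: doubleton_eq_iff numeral_2_eq_2)
  ultimately have "f ` {0, Suc 0} \<inter> f ` {1, Suc 1} = {}"
    using disjointD[OF assms] by blast
  thus False by simp
qed

lemma contains_copy_path_graphE:
  assumes "contains_copy E (path_graph l)"
  obtains f where "inj_on f {..<l}" "\<And>i. Suc i < l \<Longrightarrow> {f i, f (Suc i)} \<in> E"
proof -
  obtain f where f: "inj_on f {..<l}" "\<forall>e\<in>{{i, Suc i} |i. Suc i < l}. f ` e \<in> E"
    using assms by (auto simp: contains_copy_def path_graph_def)
  have "{f i, f (Suc i)} \<in> E" if "Suc i < l" for i
    using bspec[OF f(2), of "{i, Suc i}"] that by auto
  with f(1) show ?thesis by (rule that)
qed

lemma path_edges_card:
  assumes f: "inj_on f {..<l}" "\<And>i. Suc i < l \<Longrightarrow> {f i, f (Suc i)} \<in> E" and "finite E"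
  shows "l - 1 \<le> card E"
proof -
  have "inj_on (\<lambda>i. {f i, f (Suc i)}) {..<l - 1}"
  proof (rule inj_onI)
    fix i j assume "i \<in> {..<l - 1}" "j \<in> {..<l - 1}" "{f i, f (Suc i)} = {f j, f (Suc j)}"
    thus "i = j"
      using inj_on_eq_iff[OF f(1), of i j] inj_on_eq_iff[OF f(1), of i "Suc j"]
        inj_on_eq_iff[OF f(1), of "Suc i" j]
      by (auto simp: doubleton_eq_iff)
  qed
  moreover have "(\<lambda>i. {f i, f (Suc i)}) ` {..<l - 1} \<subseteq> E"
    using f(2) by auto
  ultimately show ?thesis
    using card_inj_on_le[of _ "{..<l - 1}" E] \<open>finite E\<close> by simp
qed

text \<open>The path contains \<open>l div 2\<close> disjoint edges, joining positions
  \<open>2 * i\<close> and \<open>2 * i + 1\<close>. Each contains a vertex of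
  \<open>\<Union>R\<close>, and \<open>\<Union>R\<close> has at most \<open>2 * card R\<close>
  vertices.\<close>

lemma path_cover_card:
  assumes f: "inj_on f {..<l}" and cover: "\<And>i. Suc i < l \<Longrightarrow> \<exists>e\<in>R. e \<inter> {f i, f (Suc i)} \<noteq> {}"
    and R: "finite R" "\<And>e. e \<in> R \<Longrightarrow> \<exists>u v. e = {u, v}"
  shows "l div 2 \<le> 2 * card R"
proof -
  have "\<exists>j. (j = 2 * i \<or> j = Suc (2 * i)) \<and> f j \<in> \<Union>R" if "i < l div 2" for i
  proof -
    have "Suc (2 * i) < l" using that by linarith
    then obtain e where "e \<in> R" "e \<inter> {f (2 * i), f (Suc (2 * i))} \<noteq> {}" using cover by blast
    thus ?thesis by blast
  qed
  then obtain g where g: "i < l div 2 \<Longrightarrow> (g i = 2 * i \<or> g i = Suc (2 * i)) \<and> f (g i) \<in> \<Union>R" for i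
    by metis
  have "inj_on (f \<circ> g) {..<l div 2}"
  proof (rule comp_inj_on)
    have "g i div 2 = i" if "i < l div 2" for i using g[OF that] by (elim conjE disjE) simp_all
    thus "inj_on g {..<l div 2}" by (intro inj_on_inverseI[of _ "\<lambda>j. j div 2"]) simp
    have "g i < l" if "i < l div 2" for i using g[OF that] that by auto
    thus "inj_on f (g ` {..<l div 2})" by (intro inj_on_subset[OF f]) auto
  qed
  moreover have "(f \<circ> g) ` {..<l div 2} \<subseteq> \<Union>R" using g by auto
  moreover have "finite (\<Union>R)" using R by (metis finite.emptyI finite.insertI finite_Union)
  ultimately have "l div 2 \<le> card (\<Union>R)" using card_inj_on_le[of "f \<circ> g" "{..<l div 2}" "\<Union>R"] by simp
  also have "\<dots> \<le> (\<Sum>e\<in>R. card e)" by (rule card_Union_le_sum_card)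
  also have "\<dots> \<le> (\<Sum>e\<in>R. 2)"
  proof (rule sum_mono)
    fix e assume "e \<in> R"
    then obtain u v where "e = {u, v}" using R(2) by blast
    thus "card e \<le> 2" by (simp add: card_insert_if)
  qed
  finally show ?thesis by simp
qed

section \<open>Painter who avoids green\<close>

text \<open>\<open>skip\<close> describes the edges that Painter colors green although red or blue is available.\<close>

definition greedy :: "(history \<Rightarrow> nat set \<Rightarrow> bool) \<Rightarrow> painter_strategy" where
  "greedy skip h e =
     (if skip h e then Green
      else if \<forall>e'\<in>color_class h Red. e \<inter> e' = {} then Red
      else if \<forall>e'\<in>color_class h Blue. e \<inter> e' = {} then Blue
      else Green)"

lemma greedy_matchings:
  "c \<noteq> Green \<Longrightarrow> disjoint (color_class (play \<sigma> (greedy skip) k) c)"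
proof (induction k)
  case 0 thus ?case by (simp add: color_class_def)
next
  case (Suc k)
  let ?h = "play \<sigma> (greedy skip) k"
  show ?case
  proof (cases "greedy skip ?h (\<sigma> ?h) = c")
    case True
    with Suc.prems have "\<forall>e'\<in>color_class ?h c. \<sigma> ?h \<inter> e' = {}"
      by (cases c) (auto simp: greedy_def split: if_splits)
    thus ?thesis using Suc True
      by (auto simp: Let_def color_class_Cons disjoint_def)
  qed (use Suc in \<open>auto simp: Let_def color_class_Cons\<close>)
qed

lemma greedy_won:
  assumes "won l (play \<sigma> (greedy skip) k)"
  shows "contains_copy (color_class (play \<sigma> (greedy skip) k) Green) (path_graph l)"
  using assms no_cherry_in_matching[OF greedy_matchings[of Red \<sigma> skip k]]
    no_cherry_in_matching[OF greedy_matchings[of Blue \<sigma> skip k]]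
  unfolding builder_won_def by simp

text \<open>Red is preferred to blue. This preference supplies the additional round for
  \<open>l = 4\<close>.\<close>

lemma greedy_blue_touches_red:
  "e \<in> color_class (play \<sigma> (greedy skip) k) Blue \<Longrightarrow>
     \<exists>e'\<in>color_class (play \<sigma> (greedy skip) k) Red. e \<inter> e' \<noteq> {}"
proof (induction k)
  case 0 thus ?case by (simp add: color_class_def)
next
  case (Suc k)
  let ?h = "play \<sigma> (greedy skip) k"
  show ?case
  proof (cases "e \<in> color_class ?h Blue")
    case True
    thus ?thesis using Suc by (auto simp: Let_def color_class_Cons)
  next
    case False
    hence "greedy skip ?h (\<sigma> ?h) = Blue" "e = \<sigma> ?h"
      using Suc.prems by (auto simp: Let_def color_class_Cons split: if_splits)
    moreover from this have "\<exists>e'\<in>color_class ?h Red. e \<inter> e' \<noteq> {}"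
      by (auto simp: greedy_def split: if_splits)
    ultimately show ?thesis by (auto simp: Let_def color_class_Cons)
  qed
qed

text \<open>Without skipping, green is used only when both other colors are blocked. So the red
  edges cover the green ones, and so do the blue edges.\<close>

lemma greedy_green_touches:
  assumes "\<And>h e. \<not> skip h e" "c \<noteq> Green"
  shows "e \<in> color_class (play \<sigma> (greedy skip) k) Green \<Longrightarrow>
     \<exists>e'\<in>color_class (play \<sigma> (greedy skip) k) c. e' \<inter> e \<noteq> {}"
  using assms(2)
proof (induction k)
  case 0 thus ?case by (simp add: color_class_def)
next
  case (Suc k)
  let ?h = "play \<sigma> (greedy skip) k"
  show ?case
  proof (cases "e \<in> color_class ?h Green")
    case True
    thus ?thesis using Suc by (auto simp: Let_def color_class_Cons)
  next
    case False
    hence "greedy skip ?h (\<sigma> ?h) = Green" "e = \<sigma> ?h"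
      using Suc.prems by (auto simp: Let_def color_class_Cons split: if_splits)
    moreover from this have "\<exists>e'\<in>color_class ?h c. e' \<inter> e \<noteq> {}"
      using assms by (cases c) (auto simp: greedy_def Int_commute split: if_splits)
    ultimately show ?thesis by (auto simp: Let_def color_class_Cons)
  qed
qed

text \<open>Two vertices that cover all three edges of a \<open>P_4\<close> must include
  \<open>f 1\<close> or \<open>f 2\<close>; the middle edge itself is excluded because it is
  green.\<close>

lemma P4_cover_pairs:
  assumes "inj_on f {..<4::nat}" "r = {x, y}" "x \<noteq> y" "r \<noteq> {f 1, f 2}"
    and "\<And>i. Suc i < 4 \<Longrightarrow> r \<inter> {f i, f (Suc i)} \<noteq> {}"
  shows "r = {f 0, f 2} \<or> r = {f 1, f 3}"
proof -
  have "r \<inter> {f 0, f 1} \<noteq> {}" "r \<inter> {f 1, f 2} \<noteq> {}" "r \<inter> {f 2, f 3} \<noteq> {}"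
    using assms(5)[of 0] assms(5)[of 1] assms(5)[of 2] by (auto simp: numeral_2_eq_2 numeral_3_eq_3)
  moreover have "f 0 \<noteq> f 1" "f 0 \<noteq> f 2" "f 0 \<noteq> f 3" "f 1 \<noteq> f 2" "f 1 \<noteq> f 3" "f 2 \<noteq> f 3"
    using assms(1) by (simp_all add: inj_on_eq_iff)
  ultimately show ?thesis using assms(2-4) by (auto simp: doubleton_eq_iff)
qed

text \<open>Red and blue each need half of \<open>l div 2\<close> edges, rounded up, and green needs
  \<open>l - 1\<close>. The sum equals \<open>rounds l\<close> except for \<open>l = 4\<close>,
  where it is one too small; it would also be one too small for \<open>l mod 4 = 1\<close>.\<close>

lemma greedy_lower_bound:
  assumes \<sigma>: "legal_builder \<sigma>" and l: "2 \<le> l" "l mod 4 \<noteq> 1"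
    and won: "won l (play \<sigma> (greedy (\<lambda>_ _. False)) k)"
  shows "rounds l \<le> k"
proof -
  define h where "h = play \<sigma> (greedy (\<lambda>_ _. False)) k"
  define R B G where "R = color_class h Red" and "B = color_class h Blue" and "G = color_class h Green"
  have legal: "legal_history h" and "length h = k"
    unfolding h_def using play_legal[OF \<sigma>] by auto
  hence k: "k = card R + card B + card G"
    using legal_history_length[OF legal] by (simp add: R_def B_def G_def)
  obtain f where f: "inj_on f {..<l}" "\<And>i. Suc i < l \<Longrightarrow> {f i, f (Suc i)} \<in> G"
    using greedy_won[OF won] contains_copy_path_graphE unfolding G_def h_def by metis
  have G: "l - 1 \<le> card G"
    by (rule path_edges_card[OF f]) (simp_all add: G_def)
  have cover: "\<exists>e\<in>color_class h c. e \<inter> {f i, f (Suc i)} \<noteq> {}" if "c \<noteq> Green" "Suc i < l" for c i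
    using greedy_green_touches[of "\<lambda>_ _. False" c "{f i, f (Suc i)}" \<sigma> k] f(2)[OF that(2)] that(1)
    unfolding G_def h_def by blast
  have half: "l div 2 \<le> 2 * card (color_class h c)" if "c \<noteq> Green" for c
    by (rule path_cover_card[OF f(1)])
       (use cover[OF that] color_class_edge[OF legal, of _ c] in \<open>simp_all, metis\<close>)
  have RB: "l div 2 \<le> 2 * card R" "l div 2 \<le> 2 * card B"
    unfolding R_def B_def by (rule half; simp)+
  show ?thesis
  \<comment> \<open>With five rounds there would be one red and one blue edge, each covering the
    green \<open>P_4\<close>. Being distinct they would be \<open>{f 0, f 2}\<close> and
    \<open>{f 1, f 3}\<close>, which are disjoint, although every blue edge meets a red one.\<close>
  proof (cases "l = 4 \<and> k < 6")
    case True
    hence "card R = 1" "card B = 1" using RB G k by auto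
    then obtain r b where rb: "R = {r}" "B = {b}" by (auto simp: card_1_singleton_iff)
    have in_class: "r \<in> color_class h Red" "b \<in> color_class h Blue"
      using rb by (auto simp: R_def B_def)
    have "r \<noteq> b" using color_class_disjoint[OF legal in_class(1)] in_class(2) by auto
    have "{f 1, f 2} \<in> color_class h Green"
      using f(2)[of 1] True by (simp add: G_def numeral_2_eq_2)
    hence "r \<noteq> {f 1, f 2}" "b \<noteq> {f 1, f 2}"
      using color_class_disjoint[OF legal] in_class by auto
    moreover have "r \<inter> {f i, f (Suc i)} \<noteq> {}" "b \<inter> {f i, f (Suc i)} \<noteq> {}" if "Suc i < 4" for i
      using cover[of Red i] cover[of Blue i] that True rb by (auto simp: R_def B_def)
    ultimately have "r = {f 0, f 2} \<or> r = {f 1, f 3}" "b = {f 0, f 2} \<or> b = {f 1, f 3}"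
      using P4_cover_pairs[of f] color_class_edge[OF legal in_class(1)]
        color_class_edge[OF legal in_class(2)] f(1) True by metis+
    moreover have "b \<inter> r \<noteq> {}"
      using greedy_blue_touches_red[of b \<sigma> _ k] in_class rb by (auto simp: R_def h_def)
    moreover have "{f 0, f 2} \<inter> {f 1, f 3} = {}"
      using f(1) True by (simp add: inj_on_eq_iff)
    ultimately show ?thesis using \<open>r \<noteq> b\<close> by auto
  next
    case False
    have "l = 4 * (l div 4) + l mod 4" by simp
    moreover have "l mod 4 < 4" by simp
    hence "l mod 4 = 0 \<or> l mod 4 = 2 \<or> l mod 4 = 3" using l(2) by linarith
    ultimately obtain q where "l = 4 * q \<or> l = 4 * q + 2 \<or> l = 4 * q + 3" by (metis add_0_right)
    thus ?thesis
    proof (elim disjE)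
      assume q: "l = 4 * q"
      have "q \<le> card R" "q \<le> card B" "4 * q - 1 \<le> card G" using RB G by (simp_all add: q)
      \<comment> \<open>For \<open>q = 1\<close> the three bounds add up to 5 only; the sixth round
        comes from \<open>False\<close>.\<close>
      thus ?thesis using False l(1) by (auto simp: rounds_def q k)
    next
      assume q: "l = 4 * q + 2"
      have "Suc q \<le> card R" "Suc q \<le> card B" "4 * q + 1 \<le> card G" using RB G by (simp_all add: q)
      moreover have "rounds l = 6 * q + 3" using mod_mult_self4[of 4 q 2] by (simp add: rounds_def q)
      ultimately show ?thesis by (simp add: k)
    next
      assume q: "l = 4 * q + 3"
      have "Suc q \<le> card R" "Suc q \<le> card B" "4 * q + 2 \<le> card G" using RB G by (simp_all add: q)
      moreover have "rounds l = 6 * q + 4" using mod_mult_self4[of 4 q 3] by (simp add: rounds_def q)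
      ultimately show ?thesis by (simp add: k)
    qed
  qed
qed

section \<open>Painter who also avoids red-blue cycles\<close>

definition nongreen :: "history \<Rightarrow> nat set set" where
  "nongreen h = color_class h Red \<union> color_class h Blue"

text \<open>Coloring such an edge red or blue would close a cycle of red and blue edges.\<close>

definition linked :: "history \<Rightarrow> nat set \<Rightarrow> bool" where
  "linked h e \<longleftrightarrow> (\<exists>u v. e = {u, v} \<and> (u, v) \<in> {(x, y). {x, y} \<in> nongreen h}\<^sup>*)"

definition deg :: "nat set set \<Rightarrow> nat \<Rightarrow> nat" where
  "deg N v = card {e \<in> N. v \<in> e}"

text \<open>For a finite set of two-element edges this is acyclicity, stated in the counting form in
  which \<open>forest_lower_bound\<close> uses it.\<close>

definition forest :: "nat set set \<Rightarrow> bool" where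
  "forest N \<longleftrightarrow> (\<forall>M \<subseteq> N. M \<noteq> {} \<longrightarrow> card M + 1 \<le> card (\<Union>M))"

lemma nongreen_Cons:
  "nongreen ((e, c) # h) = (if c = Green then nongreen h else insert e (nongreen h))"
  by (cases c) (auto simp: nongreen_def color_class_Cons)

lemma finite_nongreen [simp]: "finite (nongreen h)"
  by (simp add: nongreen_def)

text \<open>The edges of \<open>M\<close> other than \<open>{u, v}\<close> lie either inside the
  component of \<open>u\<close> or outside it. Each part, together with \<open>u\<close> or
  \<open>v\<close> respectively, spans at least one vertex more than it has edges; the two vertex
  sets are disjoint, which pays for the new edge.\<close>

lemma forest_insert:
  assumes forest: "forest N" and fin: "finite N" and pairs: "\<And>e. e \<in> N \<Longrightarrow> \<exists>x y. e = {x, y}"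
    and unlinked: "(u, v) \<notin> {(x, y). {x, y} \<in> N}\<^sup>*"
  shows "forest (insert {u, v} N)"
  unfolding forest_def
proof (intro allI impI)
  fix M assume M: "M \<subseteq> insert {u, v} N" "M \<noteq> {}"
  define C where "C = {x. (u, x) \<in> {(x, y). {x, y} \<in> N}\<^sup>*}"
  define M' where "M' = M - {{u, v}}"
  define Mu where "Mu = {e \<in> M'. e \<subseteq> C}"
  define Mv where "Mv = M' - Mu"
  have MN: "M' \<subseteq> N" using M by (auto simp: M'_def)
  have finM: "finite M'" using MN fin finite_subset by blast
  have uC: "u \<in> C" and vC: "v \<notin> C" using unlinked by (auto simp: C_def)
  have closed: "y \<in> C" if "x \<in> C" "{x, y} \<in> N" for x y
    using that by (auto simp: C_def intro: rtrancl_into_rtrancl)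
  have outside: "e \<inter> C = {}" if "e \<in> Mv" for e
  proof -
    have "e \<in> N" "\<not> e \<subseteq> C" using that MN by (auto simp: Mv_def Mu_def)
    moreover obtain x y where "e = {x, y}" using pairs \<open>e \<in> N\<close> by blast
    ultimately show ?thesis using closed[of x y] closed[of y x] by (auto simp: insert_commute)
  qed
  \<comment> \<open>The added vertex \<open>w\<close> makes the bound valid for an empty part as
    well.\<close>
  have card_union: "card K + 1 \<le> card (insert w (\<Union>K))" if "K \<subseteq> M'" for K w
  proof (cases "K = {}")
    case False
    have "finite (\<Union>K)" using that finM MN pairs
      by (metis finite.emptyI finite.insertI finite_Union finite_subset subsetD)
    hence "card (\<Union>K) \<le> card (insert w (\<Union>K))" by (intro card_mono) auto
    moreover have "card K + 1 \<le> card (\<Union>K)"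
      using forest that MN False unfolding forest_def by (meson order_trans)
    ultimately show ?thesis by linarith
  qed auto
  show "card M + 1 \<le> card (\<Union>M)"
  proof (cases "{u, v} \<in> M")
    case False
    thus ?thesis using forest M unfolding forest_def by (metis subset_insert)
  next
    case True
    have sub: "Mu \<subseteq> M'" "Mv \<subseteq> M'" by (auto simp: Mu_def Mv_def)
    have union: "\<Union>M = insert u (\<Union>Mu) \<union> insert v (\<Union>Mv)"
      using True by (auto simp: Mu_def Mv_def M'_def)
    have disj: "insert u (\<Union>Mu) \<inter> insert v (\<Union>Mv) = {}"
      using uC vC outside by (auto simp: Mu_def)
    have "\<And>K. K \<subseteq> M' \<Longrightarrow> finite (\<Union>K)" using finM MN pairs
      by (metis finite.emptyI finite.insertI finite_Union finite_subset subsetD)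
    hence "card (\<Union>M) = card (insert u (\<Union>Mu)) + card (insert v (\<Union>Mv))"
      unfolding union using sub disj by (intro card_Un_disjoint) auto
    moreover have "card M' = card Mu + card Mv"
      using finM sub by (simp add: Mv_def card_Diff_subset card_mono finite_subset)
    moreover have "card M = Suc (card M')"
      using True finM card_Suc_Diff1[of M "{u, v}"] by (simp add: M'_def)
    ultimately show ?thesis using card_union[OF sub(1), of u] card_union[OF sub(2), of v] by linarith
  qed
qed

lemma nongreen_edge:
  assumes "legal_history h" "e \<in> nongreen h"
  shows "\<exists>x y. e = {x, y}"
  using assms color_class_edge unfolding nongreen_def by (metis UnE)

lemma nongreen_forest:
  assumes "legal_builder \<sigma>"
  shows "forest (nongreen (play \<sigma> (greedy linked) k))"
proof (induction k)
  case 0 thus ?case by (simp add: forest_def nongreen_def color_class_def)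
next
  case (Suc k)
  let ?h = "play \<sigma> (greedy linked) k"
  obtain u v where uv: "\<sigma> ?h = {u, v}" using assms unfolding legal_builder_def by blast
  show ?case
  proof (cases "greedy linked ?h (\<sigma> ?h) = Green")
    case True thus ?thesis using Suc by (simp add: Let_def nongreen_Cons)
  next
    case False
    hence "\<not> linked ?h {u, v}" by (auto simp: greedy_def uv)
    hence "forest (insert {u, v} (nongreen ?h))"
      by (intro forest_insert Suc nongreen_edge[OF play_legal(1)[OF assms]])
         (auto simp: linked_def)
    thus ?thesis using False by (simp add: Let_def nongreen_Cons uv)
  qed
qed

lemma deg_mono: "N \<subseteq> N' \<Longrightarrow> finite N' \<Longrightarrow> deg N v \<le> deg N' v"
  unfolding deg_def by (rule card_mono) auto

lemma deg_pos:
  assumes "finite N" "e \<in> N" "v \<in> e"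
  shows "1 \<le> deg N v"
proof -
  have "{e \<in> N. v \<in> e} \<noteq> {}" using assms by auto
  thus ?thesis using assms(1) by (simp add: deg_def Suc_le_eq card_gt_0_iff)
qed

lemma linked_deg_pos:
  assumes "finite N" "(u, v) \<in> {(x, y). {x, y} \<in> N}\<^sup>*" "u \<noteq> v"
  shows "1 \<le> deg N u" "1 \<le> deg N v"
proof -
  obtain x where "{u, x} \<in> N" using assms(2,3) by (cases rule: converse_rtranclE) auto
  thus "1 \<le> deg N u" using deg_pos[OF assms(1)] by blast
  obtain y where "{y, v} \<in> N" using assms(2,3) by (cases rule: rtranclE) auto
  thus "1 \<le> deg N v" using deg_pos[OF assms(1)] by blast
qed

lemma two_edges_deg:
  assumes "finite N" "e \<in> N" "e' \<in> N" "e \<noteq> e'" "{u, v} \<inter> e \<noteq> {}" "{u, v} \<inter> e' \<noteq> {}"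
  shows "2 \<le> deg N u + deg N v"
proof (cases "(u \<in> e \<and> v \<in> e') \<or> (v \<in> e \<and> u \<in> e')")
  case True
  hence "1 \<le> deg N u \<and> 1 \<le> deg N v"
    using deg_pos[OF assms(1,2)] deg_pos[OF assms(1,3)] by blast
  thus ?thesis by linarith
next
  case False
  then obtain w where w: "w \<in> {u, v}" "w \<in> e" "w \<in> e'" using assms by auto
  have "card {e, e'} \<le> deg N w"
    unfolding deg_def using assms w by (intro card_mono) auto
  thus ?thesis using w assms(4) by auto
qed

text \<open>Skipped edges need not touch both colors, so the covering property is replaced by this
  weaker degree bound. A linked edge has red or blue edges at both ends; any other green edge meets
  a red edge and a different blue edge.\<close>

lemma green_deg:
  assumes "legal_builder \<sigma>" and "{u, v} \<in> color_class (play \<sigma> (greedy linked) k) Green"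
  shows "2 \<le> deg (nongreen (play \<sigma> (greedy linked) k)) u + deg (nongreen (play \<sigma> (greedy linked) k)) v"
  using assms(2)
proof (induction k)
  case 0 thus ?case by (simp add: color_class_def)
next
  case (Suc k)
  let ?h = "play \<sigma> (greedy linked) k"
  let ?N = "nongreen ?h"
  have "2 \<le> deg ?N u + deg ?N v"
  proof (cases "{u, v} \<in> color_class ?h Green")
    case True thus ?thesis by (rule Suc.IH)
  next
    case False
    hence green: "greedy linked ?h {u, v} = Green" and uv: "\<sigma> ?h = {u, v}"
      using Suc.prems by (auto simp: Let_def color_class_Cons split: if_splits)
    have "u \<noteq> v"
    proof
      assume "u = v"
      moreover obtain x y where "x \<noteq> y" "\<sigma> ?h = {x, y}" using assms(1) unfolding legal_builder_def by blast
      ultimately show False using uv by (auto simp: doubleton_eq_iff)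
    qed
    show ?thesis
    proof (cases "linked ?h {u, v}")
      case True
      then obtain x y where xy: "{u, v} = {x, y}" "(x, y) \<in> {(x, y). {x, y} \<in> ?N}\<^sup>*"
        by (auto simp: linked_def)
      hence "x \<noteq> y" using \<open>u \<noteq> v\<close> by auto
      from linked_deg_pos[OF finite_nongreen xy(2) this] xy(1) show ?thesis
        by (auto simp: doubleton_eq_iff)
    next
      case False
      hence "\<exists>e\<in>color_class ?h Red. {u, v} \<inter> e \<noteq> {}" "\<exists>e\<in>color_class ?h Blue. {u, v} \<inter> e \<noteq> {}"
        using green by (auto simp: greedy_def split: if_splits)
      then obtain e e' where e: "e \<in> color_class ?h Red" "{u, v} \<inter> e \<noteq> {}"
        "e' \<in> color_class ?h Blue" "{u, v} \<inter> e' \<noteq> {}" by metis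
      hence "e \<noteq> e'"
        using color_class_disjoint[OF play_legal(1)[OF assms(1)], of e _ k Red Blue] by auto
      thus ?thesis using e by (intro two_edges_deg[of _ e e']) (auto simp: nongreen_def)
    qed
  qed
  \<comment> \<open>Degrees never decrease, so the bound at the time of drawing persists.\<close>
  moreover have "?N \<subseteq> nongreen (play \<sigma> (greedy linked) (Suc k))"
    by (auto simp: Let_def nongreen_Cons)
  ultimately show ?case
    using deg_mono[of ?N "nongreen (play \<sigma> (greedy linked) (Suc k))" u]
      deg_mono[of ?N "nongreen (play \<sigma> (greedy linked) (Suc k))" v] by simp
qed

text \<open>Double counting of incidences; an edge has at most two of its ends in
  \<open>V\<close>.\<close>

lemma sum_deg_le:
  assumes "finite N" "finite V" "\<And>e. e \<in> N \<Longrightarrow> \<exists>x y. e = {x, y}"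
  shows "(\<Sum>v\<in>V. deg N v) \<le> 2 * card N"
proof -
  have "(\<Sum>v\<in>V. deg N v) = (\<Sum>v\<in>V. \<Sum>e\<in>N. if v \<in> e then 1 else 0)"
    using assms(1) by (simp add: deg_def sum.If_cases Int_def)
  also have "\<dots> = (\<Sum>e\<in>N. \<Sum>v\<in>V. if v \<in> e then 1 else 0)" by (rule sum.swap)
  also have "\<dots> \<le> (\<Sum>e\<in>N. 2)"
  proof (rule sum_mono)
    fix e assume "e \<in> N"
    then obtain x y where e: "e = {x, y}" using assms(3) by blast
    have "(\<Sum>v\<in>V. if v \<in> e then 1 else 0) = card (V \<inter> e)"
      using assms(2) by (simp add: sum.If_cases)
    also have "\<dots> \<le> card e" unfolding e by (intro card_mono) auto
    also have "\<dots> \<le> 2" by (simp add: e card_insert_if)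
    finally show "(\<Sum>v\<in>V. if v \<in> e then 1 else 0) \<le> (2 :: nat)" .
  qed
  finally show ?thesis by simp
qed

lemma pair_sum_ge:
  fixes a :: "nat \<Rightarrow> nat"
  assumes "\<And>i. Suc i < s + 2 * m \<Longrightarrow> 2 \<le> a i + a (Suc i)"
  shows "2 * m \<le> sum a {s..<s + 2 * m}"
  using assms
proof (induction m)
  case (Suc m)
  have "2 * m \<le> sum a {s..<s + 2 * m}" using Suc by simp
  moreover have "2 \<le> a (s + 2 * m) + a (Suc (s + 2 * m))" using Suc.prems by simp
  moreover have "sum a {s..<s + 2 * Suc m} = sum a {s..<s + 2 * m} + a (s + 2 * m) + a (Suc (s + 2 * m))"
    by simp
  ultimately show ?case by simp
qed simp

text \<open>If Builder had spent only \<open>2 q\<close> red and blue edges on a green path with \<open>4 q + 1\<close> vertices,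
  every red or blue edge would join two of the \<open>2 q\<close> vertices at odd positions, which a forest
  does not allow.\<close>

lemma forest_lower_bound:
  assumes \<sigma>: "legal_builder \<sigma>" and l: "l = 4 * q + 1" "1 \<le> q"
    and won: "won l (play \<sigma> (greedy linked) k)"
  shows "rounds l \<le> k"
proof (rule ccontr)
  assume less: "\<not> rounds l \<le> k"
  define h where "h = play \<sigma> (greedy linked) k"
  define N where "N = nongreen h"
  have legal: "legal_history h" and len: "length h = k"
    unfolding h_def using play_legal[OF \<sigma>] by auto
  have "color_class h Red \<inter> color_class h Blue = {}"
    using color_class_disjoint[OF legal, of _ Red Blue] by auto
  hence "card N = card (color_class h Red) + card (color_class h Blue)"
    unfolding N_def nongreen_def by (intro card_Un_disjoint) auto
  hence k: "k = card N + card (color_class h Green)"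
    using legal_history_length[OF legal] len by simp
  have finN: "finite N" by (simp add: N_def)
  have pairs: "\<exists>x y. e = {x, y}" if "e \<in> N" for e
    using nongreen_edge[OF legal] that unfolding N_def by blast
  obtain f where f: "inj_on f {..<l}" "\<And>i. Suc i < l \<Longrightarrow> {f i, f (Suc i)} \<in> color_class h Green"
    using greedy_won[OF won] contains_copy_path_graphE unfolding h_def by metis
  have "4 * q \<le> card (color_class h Green)"
    using path_edges_card[OF f] l by simp
  moreover have "rounds l = 6 * q + 1"
    using mod_mult_self4[of 4 q 1] l by (simp add: rounds_def)
  ultimately have N_le: "card N \<le> 2 * q" using less k by linarith
  define a where "a i = deg N (f i)" for i
  have pair: "2 \<le> a i + a (Suc i)" if "Suc i < l" for i
    using green_deg[OF \<sigma> f(2)[OF that, unfolded h_def]] by (simp add: a_def N_def h_def)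
  have sum_image: "sum a I = (\<Sum>v\<in>f ` I. deg N v)" if "I \<subseteq> {..<l}" for I
    using inj_on_subset[OF f(1) that] by (simp add: sum.reindex a_def)
  \<comment> \<open>Pairing the first \<open>4 * q\<close> path vertices shows that
    \<open>card N\<close> must be exactly \<open>2 * q\<close>.\<close>
  have "4 * q \<le> sum a {0..<0 + 2 * (2 * q)}"
    using pair_sum_ge[of 0 "2 * q" a] pair l by simp
  also have "\<dots> = (\<Sum>v\<in>f ` {0..<0 + 2 * (2 * q)}. deg N v)" by (rule sum_image) (use l in auto)
  also have "\<dots> \<le> 2 * card N" by (rule sum_deg_le[OF finN]) (use pairs in auto)
  finally have "2 * q \<le> card N" by simp
  hence "N \<noteq> {}" using l by auto
  have "\<Union>N \<subseteq> f ` {i. i < l \<and> odd i}"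
  proof (rule ccontr)
    assume "\<not> \<Union>N \<subseteq> f ` {i. i < l \<and> odd i}"
    then obtain w e where w: "w \<in> e" "e \<in> N" "w \<notin> f ` {i. i < l \<and> odd i}" by blast
    \<comment> \<open>The index \<open>j\<close> is to be deleted from the path: it is the position
      of \<open>w\<close>, or 0 if \<open>w\<close> is off the path. As \<open>j\<close> is even,
      both remaining pieces split into consecutive pairs and have total degree at least
      \<open>4 * q\<close>. The vertex \<open>w\<close> adds at least 1, exceeding
      \<open>2 * card N\<close>.\<close>
    have "\<exists>j<l. even j \<and> w \<notin> f ` ({..<l} - {j})"
    proof (cases "w \<in> f ` {..<l}")
      case True
      then obtain j where j: "j < l" "w = f j" by auto
      moreover have "even j" using w(3) j by auto
      moreover have "w \<notin> f ` ({..<l} - {j})" using j f(1) by (auto dest: inj_onD)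
      ultimately show ?thesis by blast
    next
      case False
      thus ?thesis using l by (intro exI[of _ 0]) auto
    qed
    then obtain j where j: "j < l" "even j" "w \<notin> f ` ({..<l} - {j})" by blast
    then obtain i where i: "j = 2 * i" by (elim evenE)
    have "i \<le> 2 * q" using j l i by simp
    hence l': "l = Suc j + 2 * (2 * q - i)" using l i by simp
    have "2 * i \<le> sum a {0..<0 + 2 * i}"
      by (rule pair_sum_ge) (use pair j i in auto)
    moreover have "2 * (2 * q - i) \<le> sum a {Suc j..<Suc j + 2 * (2 * q - i)}"
      by (rule pair_sum_ge) (use pair l' in auto)
    moreover have "{..<l} - {j} = {0..<j} \<union> {Suc j..<l}" using j(1) by auto
    hence "sum a ({..<l} - {j}) = sum a {0..<j} + sum a {Suc j..<l}"
      by (simp add: sum.union_disjoint)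
    ultimately have "4 * q \<le> sum a ({..<l} - {j})"
      using i l' \<open>i \<le> 2 * q\<close> by simp
    also have "\<dots> = (\<Sum>v\<in>f ` ({..<l} - {j}). deg N v)" by (rule sum_image) auto
    finally have "4 * q + 1 \<le> deg N w + (\<Sum>v\<in>f ` ({..<l} - {j}). deg N v)"
      using deg_pos[OF finN w(2,1)] by simp
    also have "\<dots> = (\<Sum>v\<in>insert w (f ` ({..<l} - {j})). deg N v)"
      using j(3) by simp
    also have "\<dots> \<le> 2 * card N" by (rule sum_deg_le[OF finN]) (use pairs in auto)
    finally show False using N_le by simp
  qed
  also have "{i. i < l \<and> odd i} = (\<lambda>i. 2 * i + 1) ` {..<2 * q}"
    using l by (auto elim!: oddE)
  finally have sub: "\<Union>N \<subseteq> f ` (\<lambda>i. 2 * i + 1) ` {..<2 * q}" .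
  have "card (\<Union>N) \<le> card (f ` (\<lambda>i. 2 * i + 1) ` {..<2 * q})"
    by (rule card_mono[OF _ sub]) simp
  also have "\<dots> \<le> card {..<2 * q}"
    by (rule order_trans[OF card_image_le card_image_le]) simp_all
  finally have "card (\<Union>N) \<le> 2 * q" by simp
  \<comment> \<open>At least \<open>2 * q\<close> edges on at most \<open>2 * q\<close> vertices
    contradict the forest property.\<close>
  moreover have "card N + 1 \<le> card (\<Union>N)"
    using nongreen_forest[OF \<sigma>, of k] \<open>N \<noteq> {}\<close> unfolding forest_def N_def h_def by blast
  ultimately show False using \<open>2 * q \<le> card N\<close> by simp
qed

section \<open>The value of the online Ramsey number\<close>

lemma rounds_le_if_builder_wins_within:
  assumes "2 \<le> l" "builder_wins_within (path_graph 3) (path_graph 3) (path_graph l) n"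
  shows "rounds l \<le> n"
proof -
  obtain \<sigma> where \<sigma>: "legal_builder \<sigma>" "\<forall>\<tau>. \<exists>k\<le>n. won l (play \<sigma> \<tau> k)"
    using assms(2) unfolding builder_wins_within_def by (elim exE conjE)
  have "\<exists>k\<le>n. rounds l \<le> k"
  proof (cases "l mod 4 = 1")
    case True
    hence l: "l = 4 * (l div 4) + 1" using mult_div_mod_eq[of 4 l] by simp
    moreover have "1 \<le> l div 4" using l assms(1) by linarith
    ultimately show ?thesis using spec[OF \<sigma>(2), of "greedy linked"] forest_lower_bound[OF \<sigma>(1)] by blast
  next
    case False
    thus ?thesis
      using spec[OF \<sigma>(2), of "greedy (\<lambda>_ _. False)"] greedy_lower_bound[OF \<sigma>(1) assms(1)] by blast
  qed
  thus ?thesis by auto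
qed

theorem theorem1p1:
  fixes l :: nat
  assumes "l \<ge> 2"
  shows "online_ramsey (path_graph 3) (path_graph 3) (path_graph l) =
    enat (if l mod 4 = 0 \<and> l \<ge> 8 then 3 * l div 2 - 1 else 3 * l div 2)"
proof -
  have "online_ramsey (path_graph 3) (path_graph 3) (path_graph l) = enat (rounds l)"
    unfolding online_ramsey_def
  proof (rule antisym)
    show "Inf (enat ` {n. builder_wins_within (path_graph 3) (path_graph 3) (path_graph l) n})
      \<le> enat (rounds l)"
      using builder_wins_within_if_forced_win[OF forced_win_rounds[OF assms]]
      by (intro Inf_lower) simp
    show "enat (rounds l)
      \<le> Inf (enat ` {n. builder_wins_within (path_graph 3) (path_graph 3) (path_graph l) n})"
      using rounds_le_if_builder_wins_within[OF assms] by (intro Inf_greatest) auto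
  qed
  thus ?thesis by (simp add: rounds_def)
qed

end
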